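(* Let $d\ge2$. For all $t$ let $C_t=[-1,1]^d$, $\beta\in[-1,1]^d$, and $y_t=\langle x_t,\beta\rangle+\eta_t$, where $\eta_t\sim U[-1,1]$. Then for every gap $\Delta_{\mathrm{gap}}$ there is a distribution over instances with gap $\Omega(\Delta_{\mathrm{gap}})$ such that any fair algorithm has regret $$\mathrm{Regret}(T)=\tilde\Omega(1/\Delta_{\mathrm{gap}})$$ with probability $1-\delta$.
   Context: **Problem (linear bandit, one choice per round).** An instance is a parameter $\beta$, unknown to the algorithm. In each round $t=1,\dots,T$ the algorithm chooses one point $x_t\in C_t$ from a distribution $\pi_t$ depending on the past choices and observations, and observes $y_t$; the noise $\eta_t$ is drawn afresh in each round. Here $\mathrm{Regret}(T)=\sum_{t=1}^T(\max_{x\in C_t}\langle\beta,x\rangle-\langle\beta,x_t\rangle)$. The probability $1-\delta$ is over the draw of the instance $\beta$, the noise and the algorithm's randomness, and $\delta$ is the input parameter of the fair algorithm. $\tilde\Omega$ suppresses logarithmic factors. **Fairness.** An algorithm with input $\delta$ is *fair* if for every $\delta\in(0,1]$ and every $\beta$, with probability at least $1-\delta$, at every round $t$, for all $x,x'\in C_t$ with $\langle\beta,x\rangle\ge\langle\beta,x'\rangle$ one has $g_t(x)\ge g_t(x')$, where $g_t$ is the probability mass function of $\pi_t$ if $\pi_t$ is discrete and its probability density function if $\pi_t$ is continuous; if $\pi_t$ is a mixture, it is required that it can be written as $\sum_i\alpha_i\pi_{t,i}$, $\sum_i\alpha_i=1$, with each $\pi_{t,i}$ discrete or continuous and satisfying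 the corresponding condition. **Gap.** For an instance $\beta$ with $C_t=C$ for all $t$, let $\Omega$ be the set of extreme points of $C$ and $x^*$ a maximizer of $\langle\beta,x\rangle$ over $x\in C$; the gap of the instance is $\inf_{x\in\Omega,\,x\ne x^*}\langle\beta,x^*-x\rangle$.
   Formalization: Proved with probability at least 1-2δ-ε for every ε in (0,1], the hidden constant depending on ε, for all T ≥ 1/Δ_gap; the literal 1-δ is false: a fair algorithm may learn unfairly on an event of probability δ and, with small positive probability, also find the optimum fairly off it. *)

theory Defs
  imports "HOL-Probability.Probability"
begin

text \<open>
  Rounds are numbered from 0, so \<open>T\<close> rounds are \<open>{..<T}\<close>. A trajectory is a function
  \<open>\<omega>\<close> with \<open>\<omega> t = (x\<^sub>t, y\<^sub>t)\<close>, the point chosen and the value observed in round \<open>t\<close>.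
\<close>

type_synonym 'a trajectory = "nat \<Rightarrow> 'a \<times> real"

type_synonym 'a policy = "nat \<Rightarrow> 'a trajectory \<Rightarrow> 'a measure"

abbreviation round_space :: "('a::euclidean_space \<times> real) measure" where
  "round_space \<equiv> borel \<Otimes>\<^sub>M borel"

definition past :: "nat \<Rightarrow> 'a trajectory \<Rightarrow> 'a trajectory" where
  "past t \<omega> = restrict \<omega> {0..<t}"

text \<open>
  \<open>\<pi> t h\<close> is the distribution of the choice in round \<open>t\<close> after the past \<open>h\<close>, an element
  of the product space over the rounds \<open>{0..<t}\<close>. The choice set is the same in all rounds.
\<close>

definition is_policy :: "'a::euclidean_space set \<Rightarrow> 'a policy \<Rightarrow> bool" where
  "is_policy C \<pi> \<longleftrightarrow>
     (\<forall>t. \<pi> t \<in> PiM {0..<t} (\<lambda>_. round_space) \<rightarrow>\<^sub>M prob_algebra borel) \<and>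
     (\<forall>t. \<forall>h \<in> space (PiM {0..<t} (\<lambda>_. round_space :: ('a \<times> real) measure)).
        emeasure (\<pi> t h) C = 1)"

abbreviation noise :: "real measure" where
  "noise \<equiv> uniform_measure lborel {-1..1}"

definition round_kernel ::
    "'a::euclidean_space \<Rightarrow> 'a policy \<Rightarrow> nat \<Rightarrow> 'a trajectory \<Rightarrow> ('a \<times> real) measure" where
  "round_kernel \<beta> \<pi> t h =
     \<pi> t h \<bind> (\<lambda>x. noise \<bind> (\<lambda>\<eta>. return round_space (x, x \<bullet> \<beta> + \<eta>)))"

text \<open>
  The law of the infinite trajectory on the instance \<open>\<beta>\<close>: the Ionescu-Tulcea limit of the
  round kernels.
\<close>

definition trajectory_law :: "'a::euclidean_space \<Rightarrow> 'a policy \<Rightarrow> 'a trajectory measure" where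
  "trajectory_law \<beta> \<pi> =
     projective_family.lim UNIV
       (Ionescu_Tulcea.CI (round_kernel \<beta> \<pi>) (\<lambda>_. round_space)) (\<lambda>_. round_space)"

lemma prob_space_noise: "prob_space noise"
  by (rule prob_space_uniform_measure) auto

lemma Ionescu_Tulcea_round_kernel:
  fixes \<beta> :: "'a::euclidean_space"
  assumes "is_policy C \<pi>"
  shows "Ionescu_Tulcea (round_kernel \<beta> \<pi>) (\<lambda>_. round_space)"
proof -
  have N: "noise \<in> space (prob_algebra borel)"
    using prob_space_noise by (simp add: space_prob_algebra)
  have \<pi> [measurable]: "\<pi> t \<in> PiM {0..<t} (\<lambda>_. round_space) \<rightarrow>\<^sub>M prob_algebra borel" for t
    using assms by (simp add: is_policy_def)
  have "(\<lambda>p. return round_space (fst p, fst p \<bullet> \<beta> + snd p))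
      \<in> (borel \<Otimes>\<^sub>M borel) \<rightarrow>\<^sub>M prob_algebra (round_space :: ('a \<times> real) measure)"
    by (intro measurable_compose[OF _ measurable_return_prob_space]) measurable
  then have obs: "(\<lambda>(x, \<eta>). return round_space (x, x \<bullet> \<beta> + \<eta>))
      \<in> (borel \<Otimes>\<^sub>M borel) \<rightarrow>\<^sub>M prob_algebra (round_space :: ('a \<times> real) measure)"
    by (simp add: case_prod_beta)
  have "(\<lambda>x. noise \<bind> (\<lambda>\<eta>. return round_space (x, x \<bullet> \<beta> + \<eta>)))
      \<in> borel \<rightarrow>\<^sub>M prob_algebra (round_space :: ('a \<times> real) measure)"
    by (rule measurable_bind_prob_space2[OF measurable_const[OF N] obs])
  then have k: "round_kernel \<beta> \<pi> t
      \<in> PiM {0..<t} (\<lambda>_. round_space) \<rightarrow>\<^sub>M prob_algebra round_space" for t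
    unfolding round_kernel_def by (rule measurable_bind_prob_space[OF \<pi>])
  show ?thesis
  proof (rule Ionescu_Tulcea.intro)
    fix t :: nat and h assume "h \<in> space (PiM {0..<t} (\<lambda>_. round_space :: ('a \<times> real) measure))"
    then show "prob_space (round_kernel \<beta> \<pi> t h)"
      using measurable_space[OF k, of h t] by (simp add: space_prob_algebra)
  qed (rule measurable_prob_algebraD[OF k])
qed

lemma
  assumes "is_policy C \<pi>"
  shows prob_space_trajectory_law: "prob_space (trajectory_law \<beta> \<pi>)"
    and sets_trajectory_law: "sets (trajectory_law \<beta> \<pi>) = sets (PiM UNIV (\<lambda>_. round_space))"
proof -
  interpret Ionescu_Tulcea "round_kernel \<beta> \<pi>" "\<lambda>_. round_space"
    using assms by (rule Ionescu_Tulcea_round_kernel)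
  show "sets (trajectory_law \<beta> \<pi>) = sets (PiM UNIV (\<lambda>_. round_space))"
    unfolding trajectory_law_def by simp
  have "emeasure PF.lim (PF.emb UNIV {} {\<lambda>_. undefined}) = emeasure (CI {}) {\<lambda>_. undefined}"
    by (rule lim) (auto simp: PiM_empty)
  moreover have "PF.emb UNIV {} {\<lambda>_. undefined} = space PF.lim"
    by (auto simp: prod_emb_def PF.space_lim space_PiM)
  moreover have "emeasure (CI {}) {\<lambda>_. undefined} = 1"
  proof -
    interpret P: prob_space "CI {}" by (rule PF.prob_space_P) auto
    have "sets (CI {}) = sets (PiM {} (\<lambda>_. round_space))"
      by (rule PF.sets_P) auto
    from sets_eq_imp_space_eq[OF this] have "space (CI {}) = {\<lambda>_. undefined}"
      by (simp add: space_PiM)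
    then show ?thesis using P.emeasure_space_1 by simp
  qed
  ultimately show "prob_space (trajectory_law \<beta> \<pi>)"
    unfolding trajectory_law_def by (intro prob_spaceI) simp
qed

definition regret :: "'a::euclidean_space set \<Rightarrow> 'a \<Rightarrow> 'a trajectory \<Rightarrow> nat \<Rightarrow> real" where
  "regret C \<beta> \<omega> T = (\<Sum>t<T. (SUP x\<in>C. \<beta> \<bullet> x) - \<beta> \<bullet> fst (\<omega> t))"

text \<open>
  A density is determined only almost everywhere, so a continuous distribution is required to
  have some version of its density that respects the order.
\<close>

definition order_respecting :: "'a::euclidean_space set \<Rightarrow> 'a \<Rightarrow> ('a \<Rightarrow> real) \<Rightarrow> bool" where
  "order_respecting C \<beta> g \<longleftrightarrow> (\<forall>x\<in>C. \<forall>x'\<in>C. \<beta> \<bullet> x \<ge> \<beta> \<bullet> x' \<longrightarrow> g x \<ge> g x')"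

definition fair_discrete :: "'a::euclidean_space set \<Rightarrow> 'a \<Rightarrow> 'a measure \<Rightarrow> bool" where
  "fair_discrete C \<beta> P \<longleftrightarrow>
     P \<in> space (prob_algebra borel) \<and> (\<exists>S. countable S \<and> emeasure P S = 1) \<and>
     order_respecting C \<beta> (\<lambda>x. measure P {x})"

definition fair_continuous :: "'a::euclidean_space set \<Rightarrow> 'a \<Rightarrow> 'a measure \<Rightarrow> bool" where
  "fair_continuous C \<beta> P \<longleftrightarrow>
     P \<in> space (prob_algebra borel) \<and>
     (\<exists>g \<in> borel_measurable borel. (\<forall>x. 0 \<le> g x) \<and> P = density lborel (\<lambda>x. ennreal (g x)) \<and>
        order_respecting C \<beta> g)"

text \<open>
  Purely discrete and purely continuous distributions are the mixtures with all the weight on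
  one component; finite mixtures have all but finitely many weights equal to 0.
\<close>

definition fair_distribution :: "'a::euclidean_space set \<Rightarrow> 'a \<Rightarrow> 'a measure \<Rightarrow> bool" where
  "fair_distribution C \<beta> P \<longleftrightarrow>
     (\<exists>(\<alpha> :: nat \<Rightarrow> real) Q. (\<forall>i. 0 \<le> \<alpha> i) \<and> \<alpha> sums 1 \<and>
        (\<forall>i. fair_discrete C \<beta> (Q i) \<or> fair_continuous C \<beta> (Q i)) \<and>
        (\<forall>A \<in> sets borel. (\<lambda>i. \<alpha> i * measure (Q i) A) sums measure P A))"

text \<open>
  An algorithm maps its input \<open>\<delta>\<close> to a policy; \<open>B\<close> is the set of admissible instances. The
  set of trajectories on which all rounds are fair need not be measurable; it is required to
  contain a measurable set of probability at least \<open>1 - \<delta>\<close>.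
\<close>

definition fair_algorithm ::
    "'a::euclidean_space set \<Rightarrow> 'a set \<Rightarrow> (real \<Rightarrow> 'a policy) \<Rightarrow> bool" where
  "fair_algorithm C B \<A> \<longleftrightarrow>
     (\<forall>\<delta>\<in>{0<..1}. is_policy C (\<A> \<delta>) \<and>
        (\<forall>\<beta>\<in>B. \<exists>E \<in> sets (trajectory_law \<beta> (\<A> \<delta>)).
           measure (trajectory_law \<beta> (\<A> \<delta>)) E \<ge> 1 - \<delta> \<and>
           (\<forall>\<omega>\<in>E. \<forall>t. fair_distribution C \<beta> (\<A> \<delta> t (past t \<omega>)))))"

text \<open>
  If the maximizer is not unique the gap is 0 whichever maximizer is chosen (for a polytope
  \<open>C\<close>).
\<close>

definition gap :: "'a::euclidean_space set \<Rightarrow> 'a \<Rightarrow> real" where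
  "gap C \<beta> =
     (let xstar = arg_max_on (\<lambda>x. \<beta> \<bullet> x) C
      in INF x \<in> {x. x extreme_point_of C \<and> x \<noteq> xstar}. \<beta> \<bullet> (xstar - x))"

definition cube :: "(real ^ 'n::finite) set" where
  "cube = {x. \<forall>i. x $ i \<in> {-1..1}}"

text \<open>
  The probability, over the draw of the instance from \<open>D\<close>, the noise and the random choices
  of the policy, that the regret after \<open>T\<close> rounds is at least \<open>r\<close>.
\<close>

definition prob_regret_ge ::
    "'a::euclidean_space set \<Rightarrow> 'a pmf \<Rightarrow> 'a policy \<Rightarrow> nat \<Rightarrow> real \<Rightarrow> real" where
  "prob_regret_ge C D \<pi> T r =
     measure_pmf.expectation D
       (\<lambda>\<beta>. measure (trajectory_law \<beta> \<pi>) {\<omega> \<in> space (trajectory_law \<beta> \<pi>). r \<le> regret C \<beta> \<omega> T})"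

end

theory Submission
  imports Defs
begin

text \<open>
  Let \<open>\<beta>\<close> have all entries 1 except for the entry \<open>s = \<Delta> / 2\<close> at \<open>q\<close>, and let \<open>\<beta>'\<close> be \<open>\<beta>\<close> with
  this entry negated. A distribution on the cube that is fair for an instance does not lose mass
  when a set is translated by a vector on which the instance is nonnegative. Alternating a
  translation orthogonal to \<open>\<beta>\<close> with one orthogonal to \<open>\<beta>'\<close> moves a set downwards in another
  coordinate \<open>p\<close>, so a distribution fair for both instances gives mass at most \<open>1 / N\<close> to the
  points with \<open>x\<^sub>p > 1 - 1 / N\<close>: a round costs at least \<open>1 / N\<close> except with probability
  \<open>1 / N\<close>. One round distinguishes \<open>\<beta>\<close> from \<open>\<beta>'\<close> with probability at most \<open>s\<close>, so an algorithm fair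
  for \<open>\<beta>'\<close> still treats \<open>\<beta>\<close> as if it could be \<open>\<beta>'\<close> during \<open>\<epsilon> / (4 \<Delta>)\<close> rounds, and Markov's
  inequality bounds the number of cheap ones among them. The point mass at \<open>\<beta>\<close> is hence a
  sufficient distribution over instances.

  Fairness is not known to be a measurable property of the past, so the change of measure is
  applied to its consequence for finitely many test sets.
\<close>

subsection \<open>Fair distributions and translations\<close>

lemma sets_borel_translation:
  fixes v :: "'a::euclidean_space"
  assumes "A \<in> sets borel"
  shows "(+) v ` A \<in> sets borel"
proof -
  have "(+) v ` A = (\<lambda>x. x - v) -` A \<inter> space borel"
    by (auto simp: image_iff algebra_simps intro!: bexI[of _ "_ - v"])
  also have "\<dots> \<in> sets borel"
    by (rule measurable_sets[OF _ assms]) simp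
  finally show ?thesis .
qed

text \<open>Each point \<open>v + x\<close> is at least as heavy as \<open>x\<close>. Summing over
  the countably many atoms in \<open>A\<close> carries this over to sets, because the translation is
  injective.\<close>

lemma fair_discrete_shift:
  fixes Q :: "'a::euclidean_space measure"
  assumes Q: "fair_discrete C \<beta> Q" and A: "A \<in> sets borel" "A \<subseteq> C"
    and vA: "(+) v ` A \<subseteq> C" and v: "0 \<le> \<beta> \<bullet> v"
  shows "measure Q A \<le> measure Q ((+) v ` A)"
proof -
  obtain S where S: "countable S" "emeasure Q S = 1"
    and ps: "prob_space Q" and sets: "sets Q = sets borel"
    and ord: "order_respecting C \<beta> (\<lambda>x. measure Q {x})"
    using Q by (auto simp: fair_discrete_def space_prob_algebra)
  interpret prob_space Q by fact
  have [measurable]: "S \<in> sets Q"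
    by (rule sets.countable) (auto simp: sets S)
  have [measurable]: "A \<in> sets Q" and vAQ: "(+) v ` A \<in> sets Q"
    using A sets_borel_translation by (auto simp: sets)
  have "AE x in Q. x \<in> S"
    using S(2) by (subst prob_eq_1[symmetric]) (auto simp: emeasure_eq_measure)
  then have "emeasure Q A = emeasure Q (A \<inter> S)"
    by (intro emeasure_eq_AE) auto
  also have "\<dots> = (\<integral>\<^sup>+x. emeasure Q {x} \<partial>count_space (A \<inter> S))"
    by (rule emeasure_countable_singleton) (auto simp: sets S)
  also have "\<dots> \<le> (\<integral>\<^sup>+x. emeasure Q {v + x} \<partial>count_space (A \<inter> S))"
  proof (rule nn_integral_mono)
    fix x assume "x \<in> space (count_space (A \<inter> S))"
    then have "x \<in> C" "v + x \<in> C" using A vA by auto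
    then have "measure Q {x} \<le> measure Q {v + x}"
      using ord v by (auto simp: order_respecting_def inner_add_right)
    then show "emeasure Q {x} \<le> emeasure Q {v + x}"
      by (simp add: emeasure_eq_measure)
  qed
  also have "\<dots> = (\<integral>\<^sup>+y. emeasure Q {y} \<partial>count_space ((+) v ` (A \<inter> S)))"
    by (rule nn_integral_bij_count_space) (auto simp: bij_betw_def)
  also have "\<dots> = emeasure Q ((+) v ` (A \<inter> S))"
    by (rule emeasure_countable_singleton[symmetric]) (auto simp: sets S)
  also have "\<dots> \<le> emeasure Q ((+) v ` A)"
    by (intro emeasure_mono vAQ) auto
  finally show ?thesis
    by (simp add: emeasure_eq_measure)
qed

text \<open>The density at \<open>v + x\<close> is at least the density at \<open>x\<close>, and
  Lebesgue measure is invariant under translations.\<close>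

lemma fair_continuous_shift:
  fixes Q :: "'a::euclidean_space measure"
  assumes Q: "fair_continuous C \<beta> Q" and A: "A \<in> sets borel" "A \<subseteq> C"
    and vA: "(+) v ` A \<subseteq> C" and v: "0 \<le> \<beta> \<bullet> v"
  shows "measure Q A \<le> measure Q ((+) v ` A)"
proof -
  obtain g where ps: "prob_space Q" and g[measurable]: "g \<in> borel_measurable borel"
    and Q_eq: "Q = density lborel (\<lambda>x. ennreal (g x))" and ord: "order_respecting C \<beta> g"
    using Q by (auto simp: fair_continuous_def space_prob_algebra)
  interpret prob_space Q by fact
  note [measurable] = A(1) sets_borel_translation[OF A(1), of v]
  have "emeasure Q A = (\<integral>\<^sup>+x. ennreal (g x) * indicator A x \<partial>lborel)"
    unfolding Q_eq by (rule emeasure_density) auto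
  also have "\<dots> \<le> (\<integral>\<^sup>+x. ennreal (g (v + x)) * indicator ((+) v ` A) (v + x) \<partial>lborel)"
  proof (rule nn_integral_mono)
    fix x
    show "ennreal (g x) * indicator A x \<le> ennreal (g (v + x)) * indicator ((+) v ` A) (v + x)"
    proof (cases "x \<in> A")
      case True
      then have "g x \<le> g (v + x)"
        using ord v A vA by (auto simp: order_respecting_def inner_add_right subset_eq)
      with True show ?thesis by (auto intro!: ennreal_leI)
    qed auto
  qed
  also have "\<dots> = (\<integral>\<^sup>+y. ennreal (g y) * indicator ((+) v ` A) y \<partial>distr lborel borel ((+) v))"
    by (subst nn_integral_distr) auto
  also have "\<dots> = emeasure Q ((+) v ` A)"
    unfolding lborel_distr_plus Q_eq by (rule emeasure_density[symmetric]) auto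
  finally show ?thesis
    by (simp add: emeasure_eq_measure)
qed

text \<open>A mixture inherits the inequality from its components, since the weights are
  nonnegative. Fairness of a distribution enters the later arguments only in this form.\<close>

lemma fair_distribution_shift:
  fixes P :: "'a::euclidean_space measure"
  assumes P: "fair_distribution C \<beta> P" and A: "A \<in> sets borel" "A \<subseteq> C"
    and vA: "(+) v ` A \<subseteq> C" and v: "0 \<le> \<beta> \<bullet> v"
  shows "measure P A \<le> measure P ((+) v ` A)"
proof -
  obtain \<alpha> :: "nat \<Rightarrow> real" and Q where \<alpha>: "\<And>i. 0 \<le> \<alpha> i"
    and Q: "\<And>i. fair_discrete C \<beta> (Q i) \<or> fair_continuous C \<beta> (Q i)"
    and mix: "\<And>A. A \<in> sets borel \<Longrightarrow> (\<lambda>i. \<alpha> i * measure (Q i) A) sums measure P A"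
    using P unfolding fair_distribution_def by blast
  have "measure (Q i) A \<le> measure (Q i) ((+) v ` A)" for i
    using Q[of i] fair_discrete_shift[OF _ A vA v] fair_continuous_shift[OF _ A vA v] by blast
  then show ?thesis
    by (intro sums_le[OF _ mix[OF A(1)] mix[OF sets_borel_translation[OF A(1)]]] mult_left_mono \<alpha>)
qed

subsection \<open>Distributions fair for two instances\<close>

text \<open>The interval for coordinate \<open>p\<close> is half open, so slabs of width
  \<open>w\<close> whose upper ends are \<open>w\<close> apart are disjoint.\<close>

definition cube_slab :: "'n::finite \<Rightarrow> real \<Rightarrow> real \<Rightarrow> (real ^ 'n) set" where
  "cube_slab p w a = {x \<in> cube. a - w < x $ p \<and> x $ p \<le> a}"

lemma sets_cube_slab_half:
  "{x \<in> cube_slab p w a. 0 < x $ q} \<in> sets borel"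
  "{x \<in> cube_slab p w a. x $ q \<le> 0} \<in> sets borel"
  unfolding cube_slab_def cube_def by measurable

lemma sets_cube_slab: "cube_slab p w a \<in> sets borel"
  unfolding cube_slab_def cube_def by measurable

text \<open>
  A point of the slab stays in the cube if its coordinate \<open>q\<close> is first moved towards the interior,
  so the order of the two translations depends on the sign of that coordinate.
\<close>

lemma cube_slab_shift:
  fixes P :: "(real ^ 'n::finite) measure" and u d :: "real ^ 'n"
  defines "U \<equiv> \<lambda>p q w a. {x \<in> cube_slab p w a. 0 < x $ q} :: (real ^ 'n) set"
    and "L \<equiv> \<lambda>p q w a. {x \<in> cube_slab p w a. x $ q \<le> 0} :: (real ^ 'n) set"
  assumes P: "prob_space P" "sets P = sets borel" and pq: "p \<noteq> q"
    and b: "0 \<le> b" and c: "0 \<le> c" "c \<le> 1" and a: "2 * b - 1 \<le> a - w"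
    and u: "\<And>i. u $ i = (if i = p then - b else if i = q then c else 0)"
    and d: "\<And>i. d $ i = (if i = p then - b else if i = q then - c else 0)"
    and up: "\<And>A. A \<in> sets borel \<Longrightarrow> A \<subseteq> cube \<Longrightarrow> (+) u ` A \<subseteq> cube \<Longrightarrow>
        measure P A \<le> measure P ((+) u ` A)"
    and down: "\<And>A. A \<in> {U p q w a, (+) u ` L p q w a} \<Longrightarrow> A \<subseteq> cube \<Longrightarrow> (+) d ` A \<subseteq> cube \<Longrightarrow>
        measure P A \<le> measure P ((+) d ` A)"
  shows "measure P (cube_slab p w a) \<le> measure P (cube_slab p w (a - 2 * b))"
proof -
  interpret prob_space P by fact
  let ?U = "U p q w a" and ?L = "L p q w a"
  have UL [measurable]: "?U \<in> sets borel" "?L \<in> sets borel"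
    unfolding U_def L_def by (rule sets_cube_slab_half)+
  note sh = sets_borel_translation
  have cube_iff: "x \<in> cube \<longleftrightarrow> (\<forall>i. - 1 \<le> x $ i \<and> x $ i \<le> 1)" for x :: "real ^ 'n"
    by (auto simp: cube_def)
  have U_iff: "x \<in> ?U \<longleftrightarrow> x \<in> cube \<and> a - w < x $ p \<and> x $ p \<le> a \<and> 0 < x $ q" for x
    by (auto simp: U_def cube_slab_def)
  have L_iff: "x \<in> ?L \<longleftrightarrow> x \<in> cube \<and> a - w < x $ p \<and> x $ p \<le> a \<and> x $ q \<le> 0" for x
    by (auto simp: L_def cube_slab_def)
  have bounds_U: "- 1 \<le> x $ i" "x $ i \<le> 1" if "x \<in> ?U" for x i
    using that by (auto simp: U_iff cube_iff)
  have bounds_L: "- 1 \<le> x $ i" "x $ i \<le> 1" if "x \<in> ?L" for x i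
    using that by (auto simp: L_iff cube_iff)
  \<comment> \<open>Coordinate \<open>q\<close> is positive here, so lowering it by
    \<open>c \<le> 1\<close> keeps it above -1. Coordinate \<open>p\<close> has room for
    \<open>2 * b\<close> below, by the assumption on \<open>a\<close>.\<close>
  have dU: "d + x \<in> cube" if "x \<in> ?U" for x
    unfolding cube_iff
  proof
    fix i show "- 1 \<le> (d + x) $ i \<and> (d + x) $ i \<le> 1"
      using that bounds_U[OF that, of i] a b c pq by (auto simp: U_iff d)
  qed
  have uL: "u + x \<in> cube" if "x \<in> ?L" for x
    unfolding cube_iff
  proof
    fix i show "- 1 \<le> (u + x) $ i \<and> (u + x) $ i \<le> 1"
      using that bounds_L[OF that, of i] a b c pq by (auto simp: L_iff u)
  qed
  \<comment> \<open>The moves in coordinate \<open>q\<close> cancel: \<open>u + d\<close> has the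
    entry \<open>- 2 * b\<close> at \<open>p\<close> and 0 elsewhere.\<close>
  have udU: "u + (d + x) \<in> cube_slab p w (a - 2 * b)" if "x \<in> ?U" for x
  proof -
    have "- 1 \<le> (u + (d + x)) $ i \<and> (u + (d + x)) $ i \<le> 1" for i
      using that bounds_U[OF that, of i] a b c pq by (auto simp: U_iff u d)
    then show ?thesis
      using that pq by (auto simp: cube_slab_def cube_iff U_iff u d algebra_simps)
  qed
  have duL: "d + (u + x) \<in> cube_slab p w (a - 2 * b)" if "x \<in> ?L" for x
  proof -
    have "- 1 \<le> (u + (d + x)) $ i \<and> (u + (d + x)) $ i \<le> 1" for i
      using that bounds_L[OF that, of i] a b c pq by (auto simp: L_iff u d)
    then show ?thesis
      using that pq by (auto simp: cube_slab_def cube_iff L_iff u d algebra_simps)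
  qed
  have slab_cube: "cube_slab p w a' \<subseteq> cube" for a' by (auto simp: cube_slab_def)
  have "cube_slab p w a = ?U \<union> ?L" by (auto simp: U_def L_def)
  moreover have "?U \<inter> ?L = {}" by (auto simp: U_def L_def)
  ultimately have "measure P (cube_slab p w a) = measure P ?U + measure P ?L"
    by (simp add: finite_measure_Union P)
  also have "\<dots> \<le> measure P ((+) u ` (+) d ` ?U) + measure P ((+) d ` (+) u ` ?L)"
  proof (rule add_mono)
    have "measure P ((+) d ` ?U) \<le> measure P ((+) u ` (+) d ` ?U)"
      using udU slab_cube dU by (intro up sh UL) blast+
    moreover have "measure P ?U \<le> measure P ((+) d ` ?U)"
      using dU by (intro down) (auto simp: U_iff)
    ultimately show "measure P ?U \<le> measure P ((+) u ` (+) d ` ?U)" by simp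
    have "measure P ?L \<le> measure P ((+) u ` ?L)"
      using uL by (intro up UL) (auto simp: L_iff)
    moreover have "measure P ((+) u ` ?L) \<le> measure P ((+) d ` (+) u ` ?L)"
      using uL duL slab_cube by (intro down) blast+
    ultimately show "measure P ?L \<le> measure P ((+) d ` (+) u ` ?L)" by simp
  qed
  also have "\<dots> = measure P ((+) u ` (+) d ` ?U \<union> (+) d ` (+) u ` ?L)"
  proof (rule finite_measure_Union[symmetric])
    \<comment> \<open>In total both halves are translated by the same vector \<open>u + d\<close>,
      so their images remain disjoint.\<close>
    have "u + (d + x) \<noteq> d + (u + y)" if "x \<in> ?U" "y \<in> ?L" for x y
      using that by (auto simp: U_iff L_iff algebra_simps)
    then show "((+) u ` (+) d ` ?U) \<inter> ((+) d ` (+) u ` ?L) = {}" by blast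
  qed (auto simp only: P intro!: sh UL)
  also have "\<dots> \<le> measure P (cube_slab p w (a - 2 * b))"
    using udU duL by (intro finite_measure_mono) (auto simp: P sets_cube_slab)
  finally show ?thesis .
qed

text \<open>The sets that get translated by \<open>d\<close> while the slab makes \<open>n\<close>
  steps downwards. Their inequalities come from the second instance and must survive a change of
  measure; as they are finitely many, they give a measurable condition on the past.\<close>

definition test_sets :: "'n::finite \<Rightarrow> 'n \<Rightarrow> real ^ 'n \<Rightarrow> real \<Rightarrow> real \<Rightarrow> nat \<Rightarrow> (real ^ 'n) set set" where
  "test_sets p q u w b n = (\<Union>i\<in>{..<n}.
     {{x \<in> cube_slab p w (1 - real i * (2 * b)). 0 < x $ q},
      (+) u ` {x \<in> cube_slab p w (1 - real i * (2 * b)). x $ q \<le> 0}})"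

lemma finite_test_sets: "finite (test_sets p q u w b n)"
  by (simp add: test_sets_def)

lemma test_sets_borel: "A \<in> test_sets p q u w b n \<Longrightarrow> A \<in> sets borel"
  by (auto simp: test_sets_def intro: sets_cube_slab_half sets_borel_translation)

text \<open>The top slab can be moved down to \<open>N\<close> disjoint positions, each at least as heavy.\<close>

lemma top_slab_le:
  fixes P :: "(real ^ 'n::finite) measure" and u d :: "real ^ 'n" and N K :: nat
  defines "b \<equiv> 1 / (2 * real N * real K)"
  assumes P: "prob_space P" "sets P = sets borel" "emeasure P cube = 1" and pq: "p \<noteq> q"
    and NK: "0 < N" "0 < K" and c: "0 \<le> c" "c \<le> 1"
    and u: "\<And>i. u $ i = (if i = p then - b else if i = q then c else 0)"
    and d: "\<And>i. d $ i = (if i = p then - b else if i = q then - c else 0)"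
    and up: "\<And>A. A \<in> sets borel \<Longrightarrow> A \<subseteq> cube \<Longrightarrow> (+) u ` A \<subseteq> cube \<Longrightarrow>
        measure P A \<le> measure P ((+) u ` A)"
    and down: "\<And>A. A \<in> test_sets p q u (1 / N) b (N * K) \<Longrightarrow> A \<subseteq> cube \<Longrightarrow> (+) d ` A \<subseteq> cube \<Longrightarrow>
        measure P A \<le> measure P ((+) d ` A)"
  shows "measure P {x. 1 - 1 / N < x $ p} \<le> 1 / N"
proof -
  interpret prob_space P by fact
  let ?S = "\<lambda>i::nat. cube_slab p (1 / N) (1 - i * (2 * b))"
  have b0: "0 \<le> b" by (simp add: b_def)
  \<comment> \<open>One step lowers the slab by \<open>2 * b = 1 / (N * K)\<close>. So
    \<open>K\<close> steps lower it by its own width \<open>1 / N\<close>, and all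
    \<open>N * K\<close> steps lower it by 1 only, which leaves its interval inside [-1, 1].\<close>
  have bNK: "real (N * K) * (2 * b) = 1" using NK by (simp add: b_def)
  have step: "measure P (?S i) \<le> measure P (?S (Suc i))" if i: "i < N * K" for i
  proof -
    have "real (Suc i) * (2 * b) \<le> real (N * K) * (2 * b)"
      using i b0 by (intro mult_right_mono) (auto simp del: of_nat_Suc of_nat_mult)
    moreover have "1 / real N \<le> 1" using NK by simp
    ultimately have a: "2 * b - 1 \<le> (1 - i * (2 * b)) - 1 / N"
      using bNK by (simp add: algebra_simps)
    have "measure P (?S i) \<le> measure P (cube_slab p (1 / N) (1 - i * (2 * b) - 2 * b))"
      using i by (intro cube_slab_shift[OF P(1,2) pq b0 c a u d up] down) (auto simp: test_sets_def)
    then show ?thesis by (simp add: algebra_simps)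
  qed
  have chain: "measure P (?S 0) \<le> measure P (?S i)" if "i \<le> N * K" for i
    using that
  proof (induction i)
    case (Suc i)
    then show ?case using step[of i] by (simp del: of_nat_Suc)
  qed simp
  have "measure P (cube_slab p (1 / N) 1) \<le> measure P (cube_slab p (1 / N) (1 - j / N))"
    if "j < N" for j
    using chain[of "j * K"] that NK by (auto simp: b_def field_simps)
  then have "(\<Sum>j<N. measure P (cube_slab p (1 / N) 1)) \<le>
      (\<Sum>j<N. measure P (cube_slab p (1 / N) (1 - j / N)))"
    by (intro sum_mono) auto
  also have "\<dots> = measure P (\<Union>j<N. cube_slab p (1 / N) (1 - j / N))"
  proof (rule finite_measure_finite_Union[symmetric])
    \<comment> \<open>Used twice, with \<open>j\<close> and \<open>j'\<close> exchanged, this shows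
      that two slabs with a common point have the same index.\<close>
    have less: "j' < j + 1" if "x \<in> cube_slab p (1 / N) (1 - j / N)"
      "x \<in> cube_slab p (1 / N) (1 - j' / N)" for x and j j' :: nat
    proof -
      have "1 - j / N - 1 / N < 1 - j' / N" using that by (auto simp: cube_slab_def)
      then have "real j' / N < (real j + 1) / N" by (simp add: add_divide_distrib)
      then show ?thesis using NK by (simp add: divide_less_cancel)
    qed
    then have "j = j'" if "x \<in> cube_slab p (1 / N) (1 - j / N)"
      "x \<in> cube_slab p (1 / N) (1 - j' / N)" for x and j j' :: nat
      using less[OF that] less[OF that(2,1)] by simp
    then show "disjoint_family_on (\<lambda>j. cube_slab p (1 / N) (1 - j / N)) {..<N}"
      unfolding disjoint_family_on_def by blast
  qed (auto simp: P sets_cube_slab)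
  also have "\<dots> \<le> 1" by (rule prob_le_1)
  finally have "measure P (cube_slab p (1 / N) 1) \<le> 1 / N"
    using NK by (simp add: field_simps)
  moreover have "measure P {x. 1 - 1 / N < x $ p} \<le> measure P (cube_slab p (1 / N) 1)"
  proof (rule finite_measure_mono_AE)
    \<comment> \<open>In the cube coordinate \<open>p\<close> is at most 1, so the half space lies
      in the top slab up to a null set.\<close>
    have "AE x in P. x \<in> cube"
      using P(3) by (subst prob_eq_1[symmetric]) (auto simp: emeasure_eq_measure P cube_def)
    then show "AE x in P. x \<in> {x. 1 - 1 / N < x $ p} \<longrightarrow> x \<in> cube_slab p (1 / N) 1"
      by eventually_elim (auto simp: cube_slab_def cube_def)
  qed (simp add: P sets_cube_slab)
  ultimately show ?thesis by simp
qed

subsection \<open>The law of a trajectory\<close>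

text \<open>The limit is described by \<open>CI J\<close>, which runs the kernels up to
  \<open>up_to J\<close> and then restricts to \<open>J\<close>. For an initial segment
  \<open>J\<close> this restriction changes nothing.\<close>

lemma (in Ionescu_Tulcea) distr_lim_initial:
  "distr PF.lim (PiM {0..<n} M) (\<lambda>\<omega>. restrict \<omega> {0..<n}) = C 0 n (\<lambda>_. undefined)"
proof -
  have "up_to {0..<n} = n"
    using up_to[of "{0..<n}"] by (intro antisym) (auto simp: up_to_iff_Ico)
  then show ?thesis
    by (simp add: distr_lim CI_def distr_C[of n n "\<lambda>_. undefined" 0, simplified, symmetric])
qed

text \<open>The law of \<open>Suc n\<close> rounds is the law of \<open>n\<close> rounds bound with
  the kernel \<open>eP n\<close>, so the last round can be integrated first, given the past.\<close>

lemma (in Ionescu_Tulcea) nn_integral_lim_Suc: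
  assumes [measurable]: "f \<in> borel_measurable (PiM {0..<Suc n} M)"
  shows "(\<integral>\<^sup>+\<omega>. f (restrict \<omega> {0..<Suc n}) \<partial>PF.lim) =
    (\<integral>\<^sup>+\<omega>. (\<integral>\<^sup>+x. f ((restrict \<omega> {0..<n})(n := x)) \<partial>P n (restrict \<omega> {0..<n})) \<partial>PF.lim)"
proof -
  have r: "(\<lambda>\<omega>. restrict \<omega> {0..<k}) \<in> PF.lim \<rightarrow>\<^sub>M PiM {0..<k} M" for k
    by (simp add: measurable_cong_sets[OF PF.sets_lim refl] measurable_restrict_subset)
  have E: "(\<lambda>h. \<integral>\<^sup>+y. f y \<partial>eP n h) \<in> borel_measurable (PiM {0..<n} M)"
    by measurable
  have "(\<integral>\<^sup>+\<omega>. f (restrict \<omega> {0..<Suc n}) \<partial>PF.lim) = (\<integral>\<^sup>+h. f h \<partial>C 0 (Suc n) (\<lambda>_. undefined))"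
    unfolding distr_lim_initial[symmetric] by (rule nn_integral_distr[OF r, symmetric]) simp
  also have "\<dots> = (\<integral>\<^sup>+h. (\<integral>\<^sup>+y. f y \<partial>eP n h) \<partial>C 0 n (\<lambda>_. undefined))"
    unfolding C.simps(2)
    by (subst nn_integral_bind[where B="PiM {0..<Suc n} M"])
      (auto simp: measurable_cong_sets[OF sets_C refl] space_PiM intro: measurable_eP)
  also have "\<dots> = (\<integral>\<^sup>+\<omega>. (\<integral>\<^sup>+y. f y \<partial>eP n (restrict \<omega> {0..<n})) \<partial>PF.lim)"
    unfolding distr_lim_initial[symmetric] by (rule nn_integral_distr[OF r]) (simp add: E)
  also have "\<dots> = (\<integral>\<^sup>+\<omega>. (\<integral>\<^sup>+x. f ((restrict \<omega> {0..<n})(n := x)) \<partial>P n (restrict \<omega> {0..<n})) \<partial>PF.lim)"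
    by (intro nn_integral_cong nn_integral_eP measurable_space[OF r] assms) auto
  finally show ?thesis .
qed

lemma (in Ionescu_Tulcea) borel_measurable_nn_integral_P:
  assumes [measurable]: "f \<in> borel_measurable (PiM {0..<Suc n} M)"
  shows "(\<lambda>h. \<integral>\<^sup>+x. f (h(n := x)) \<partial>P n h) \<in> borel_measurable (PiM {0..<n} M)"
proof -
  have "(\<lambda>h. \<integral>\<^sup>+y. f y \<partial>eP n h) \<in> borel_measurable (PiM {0..<n} M)"
    by measurable
  then show ?thesis
    by (subst measurable_cong[OF nn_integral_eP[symmetric]]) auto
qed

section \<open>Policies and the trajectory law, one round at a time\<close>

lemma is_policyD:
  assumes "is_policy C \<pi>"
  shows "\<pi> t \<in> PiM {0..<t} (\<lambda>_. round_space) \<rightarrow>\<^sub>M prob_algebra borel"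
    and "h \<in> space (PiM {0..<t} (\<lambda>_. round_space)) \<Longrightarrow> prob_space (\<pi> t h)"
    and "h \<in> space (PiM {0..<t} (\<lambda>_. round_space)) \<Longrightarrow> sets (\<pi> t h) = sets borel"
    and "h \<in> space (PiM {0..<t} (\<lambda>_. round_space)) \<Longrightarrow> emeasure (\<pi> t h) C = 1"
proof -
  show *: "\<pi> t \<in> PiM {0..<t} (\<lambda>_. round_space) \<rightarrow>\<^sub>M prob_algebra borel"
    using assms by (simp add: is_policy_def)
  show "prob_space (\<pi> t h)" "sets (\<pi> t h) = sets borel" "emeasure (\<pi> t h) C = 1"
    if "h \<in> space (PiM {0..<t} (\<lambda>_. round_space))"
    using measurable_space[OF * that] that assms by (auto simp: space_prob_algebra is_policy_def)
qed

lemma nn_integral_round_kernel: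
  assumes \<pi>: "is_policy C \<pi>" and h: "h \<in> space (PiM {0..<t} (\<lambda>_. round_space))"
    and f [measurable]: "f \<in> borel_measurable round_space"
  shows "(\<integral>\<^sup>+z. f z \<partial>round_kernel \<beta> \<pi> t h) = (\<integral>\<^sup>+x. (\<integral>\<^sup>+\<eta>. f (x, x \<bullet> \<beta> + \<eta>) \<partial>noise) \<partial>\<pi> t h)"
proof -
  have N: "noise \<in> space (prob_algebra borel)"
    using prob_space_noise by (simp add: space_prob_algebra)
  have obs: "(\<lambda>p. return round_space (fst p, fst p \<bullet> \<beta> + snd p))
      \<in> (borel \<Otimes>\<^sub>M borel) \<rightarrow>\<^sub>M prob_algebra (round_space :: ('a \<times> real) measure)"
    by (intro measurable_compose[OF _ measurable_return_prob_space]) measurable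
  have k: "(\<lambda>x. noise \<bind> (\<lambda>\<eta>. return round_space (x, x \<bullet> \<beta> + \<eta>)))
      \<in> borel \<rightarrow>\<^sub>M prob_algebra (round_space :: ('a \<times> real) measure)"
    using obs by (intro measurable_bind_prob_space2[OF measurable_const[OF N]]) (simp add: case_prod_beta)
  have "(\<lambda>\<eta>. (x, x \<bullet> \<beta> + \<eta>)) \<in> borel \<rightarrow>\<^sub>M (round_space :: ('a \<times> real) measure)" for x
    by (intro measurable_Pair) measurable
  from measurable_compose[OF this return_measurable]
  have o1: "(\<lambda>\<eta>. return round_space (x, x \<bullet> \<beta> + \<eta>))
      \<in> noise \<rightarrow>\<^sub>M subprob_algebra (round_space :: ('a \<times> real) measure)" for x
    by (simp add: measurable_cong_sets[OF sets_uniform_measure refl])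
  have "(\<integral>\<^sup>+z. f z \<partial>round_kernel \<beta> \<pi> t h) =
      (\<integral>\<^sup>+x. (\<integral>\<^sup>+z. f z \<partial>(noise \<bind> (\<lambda>\<eta>. return round_space (x, x \<bullet> \<beta> + \<eta>)))) \<partial>\<pi> t h)"
    unfolding round_kernel_def
    by (rule nn_integral_bind[OF f])
      (subst measurable_cong_sets[OF is_policyD(3)[OF \<pi> h] refl], rule measurable_prob_algebraD[OF k])
  also have "\<dots> = (\<integral>\<^sup>+x. (\<integral>\<^sup>+\<eta>. f (x, x \<bullet> \<beta> + \<eta>) \<partial>noise) \<partial>\<pi> t h)"
    by (subst nn_integral_bind[OF f o1]) (simp add: nn_integral_return space_pair_measure)
  finally show ?thesis .
qed

lemma measurable_past [measurable]:
  "past t \<in> PiM UNIV (\<lambda>_. round_space) \<rightarrow>\<^sub>M PiM {0..<t} (\<lambda>_. round_space)"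
  unfolding past_def[abs_def] by (rule measurable_restrict_subset) simp

lemma past_past: "s \<le> t \<Longrightarrow> past s (past t \<omega>) = past s \<omega>"
  by (auto simp: past_def)

lemma space_trajectory_law:
  assumes "is_policy C \<pi>" shows "space (trajectory_law \<beta> \<pi>) = UNIV"
  using sets_eq_imp_space_eq[OF sets_trajectory_law[OF assms, of \<beta>]]
  by (simp add: space_PiM space_pair_measure)

lemma measurable_trajectory_law:
  assumes "is_policy C \<pi>"
  shows "past t \<in> trajectory_law \<beta> \<pi> \<rightarrow>\<^sub>M PiM {0..<t} (\<lambda>_. round_space)"
    and "(\<lambda>\<omega>. fst (\<omega> t)) \<in> trajectory_law \<beta> \<pi> \<rightarrow>\<^sub>M borel"
proof -
  have "(\<lambda>\<omega>. fst (\<omega> t)) \<in> PiM UNIV (\<lambda>_. round_space) \<rightarrow>\<^sub>M borel"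
    by (rule measurable_compose[OF measurable_component_singleton[of t] measurable_fst]) simp
  with measurable_past show "past t \<in> trajectory_law \<beta> \<pi> \<rightarrow>\<^sub>M PiM {0..<t} (\<lambda>_. round_space)"
    and "(\<lambda>\<omega>. fst (\<omega> t)) \<in> trajectory_law \<beta> \<pi> \<rightarrow>\<^sub>M borel"
    unfolding measurable_cong_sets[OF sets_trajectory_law[OF assms] refl] by blast+
qed

lemma sets_trajectory_law_choice:
  assumes \<pi>: "is_policy C \<pi>" and "A \<in> sets borel"
    and "H \<in> sets (PiM {0..<t} (\<lambda>_. round_space))"
  shows "{\<omega>. past t \<omega> \<in> H \<and> fst (\<omega> t) \<in> A} \<in> sets (trajectory_law \<beta> \<pi>)"
proof -
  let ?L = "trajectory_law \<beta> \<pi>"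
  have "(past t -` H \<inter> space ?L) \<inter> ((\<lambda>\<omega>. fst (\<omega> t)) -` A \<inter> space ?L) \<in> sets ?L"
    by (intro sets.Int measurable_sets[OF measurable_trajectory_law(1)[OF \<pi>]]
      measurable_sets[OF measurable_trajectory_law(2)[OF \<pi>]] assms)
  then show ?thesis
    by (simp add: space_trajectory_law[OF \<pi>] vimage_def Int_def)
qed

lemma past_in_space:
  "past t (\<omega> :: nat \<Rightarrow> 'a::euclidean_space \<times> real) \<in> space (PiM {0..<t} (\<lambda>_. round_space))"
  by (auto simp: past_def space_PiM space_pair_measure)

lemma nn_integral_trajectory_law_Suc:
  assumes \<pi>: "is_policy C \<pi>"
    and f [measurable]: "f \<in> borel_measurable (PiM {0..<Suc t} (\<lambda>_. round_space))"
  shows "(\<integral>\<^sup>+\<omega>. f (past (Suc t) \<omega>) \<partial>trajectory_law \<beta> \<pi>) =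
    (\<integral>\<^sup>+\<omega>. (\<integral>\<^sup>+x. (\<integral>\<^sup>+\<eta>. f ((past t \<omega>)(t := (x, x \<bullet> \<beta> + \<eta>))) \<partial>noise) \<partial>\<pi> t (past t \<omega>))
      \<partial>trajectory_law \<beta> \<pi>)"
proof -
  interpret Ionescu_Tulcea "round_kernel \<beta> \<pi>" "\<lambda>_. round_space"
    using \<pi> by (rule Ionescu_Tulcea_round_kernel)
  have m: "(\<lambda>z. f ((past t \<omega>)(t := z))) \<in> borel_measurable round_space" for \<omega>
    by (rule measurable_compose[OF measurable_fun_upd[where J="{0..<t}"] f])
      (auto intro!: measurable_const past_in_space)
  have "(\<integral>\<^sup>+\<omega>. f (past (Suc t) \<omega>) \<partial>trajectory_law \<beta> \<pi>) =
    (\<integral>\<^sup>+\<omega>. (\<integral>\<^sup>+z. f ((past t \<omega>)(t := z)) \<partial>round_kernel \<beta> \<pi> t (past t \<omega>)) \<partial>trajectory_law \<beta> \<pi>)"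
    unfolding trajectory_law_def past_def by (rule nn_integral_lim_Suc[OF f])
  also have "\<dots> = (\<integral>\<^sup>+\<omega>. (\<integral>\<^sup>+x. (\<integral>\<^sup>+\<eta>. f ((past t \<omega>)(t := (x, x \<bullet> \<beta> + \<eta>))) \<partial>noise) \<partial>\<pi> t (past t \<omega>))
      \<partial>trajectory_law \<beta> \<pi>)"
    by (intro nn_integral_cong nn_integral_round_kernel[OF \<pi> past_in_space m])
  finally show ?thesis .
qed

text \<open>After substitution both sides integrate \<open>g\<close> with density 1/2 over intervals
  of length 2, and the part of the first interval outside the second has length at most
  \<open>\<bar>a - b\<bar>\<close>. This is a bound on the total variation distance.\<close>

lemma nn_integral_noise_shift_le:
  fixes g :: "real \<Rightarrow> ennreal"
  assumes [measurable]: "g \<in> borel_measurable borel" and g1: "\<And>y. g y \<le> 1"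
  shows "(\<integral>\<^sup>+\<eta>. g (a + \<eta>) \<partial>noise) \<le> (\<integral>\<^sup>+\<eta>. g (b + \<eta>) \<partial>noise) + ennreal (\<bar>a - b\<bar> / 2)"
proof -
  have *: "(\<integral>\<^sup>+\<eta>. g (c + \<eta>) \<partial>noise) = (\<integral>\<^sup>+y. g y * indicator {c - 1..c + 1} y \<partial>lborel) / 2" for c
  proof -
    have "(\<integral>\<^sup>+\<eta>. g (c + \<eta>) \<partial>noise) = (\<integral>\<^sup>+\<eta>. g (c + \<eta>) * indicator {- 1..1} \<eta> \<partial>lborel) / 2"
      by (subst nn_integral_uniform_measure) auto
    also have "(\<integral>\<^sup>+\<eta>. g (c + \<eta>) * indicator {- 1..1} \<eta> \<partial>lborel) =
        (\<integral>\<^sup>+y. g y * indicator {c - 1..c + 1} y \<partial>lborel)"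
      by (subst nn_integral_real_affine[where c=1 and t=c])
        (auto intro!: nn_integral_cong split: split_indicator)
    finally show ?thesis .
  qed
  \<comment> \<open>\<open>D\<close> covers what the interval around \<open>a\<close> has beyond the
    one around \<open>b\<close>. If the two are disjoint it also covers the space between them,
    which does no harm.\<close>
  define D where "D = (if a \<le> b then {a - 1..b - 1} else {b + 1..a + 1})"
  have [measurable]: "D \<in> sets borel" by (simp add: D_def)
  have "(\<integral>\<^sup>+y. g y * indicator {a - 1..a + 1} y \<partial>lborel) \<le>
      (\<integral>\<^sup>+y. g y * indicator {b - 1..b + 1} y + indicator D y \<partial>lborel)"
    using g1 by (intro nn_integral_mono) (auto simp: D_def split: split_indicator)
  also have "\<dots> = (\<integral>\<^sup>+y. g y * indicator {b - 1..b + 1} y \<partial>lborel) + (\<integral>\<^sup>+y. indicator D y \<partial>lborel)"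
    by (rule nn_integral_add) auto
  also have "(\<integral>\<^sup>+y. indicator D y \<partial>lborel) = emeasure lborel D"
    by (rule nn_integral_indicator) simp
  also have "emeasure lborel D = ennreal \<bar>a - b\<bar>"
    by (simp add: D_def)
  finally have "(\<integral>\<^sup>+y. g y * indicator {a - 1..a + 1} y \<partial>lborel) / 2 \<le>
      ((\<integral>\<^sup>+y. g y * indicator {b - 1..b + 1} y \<partial>lborel) + ennreal \<bar>a - b\<bar>) / 2"
    by (rule divide_right_mono_ennreal)
  also have "\<dots> = (\<integral>\<^sup>+y. g y * indicator {b - 1..b + 1} y \<partial>lborel) / 2 + ennreal (\<bar>a - b\<bar> / 2)"
    using divide_ennreal[of "\<bar>a - b\<bar>" 2] by (simp add: add_divide_distrib_ennreal)
  finally show ?thesis by (simp add: *)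
qed

text \<open>Total variation distances add up over the rounds. After the same past the policy draws
  from the same distribution, whatever the instance, so only the observation changes, at a cost of
  at most \<open>e\<close> per round.\<close>

lemma nn_integral_trajectory_law_le:
  assumes \<pi>: "is_policy C \<pi>" and e: "\<And>x. x \<in> C \<Longrightarrow> \<bar>x \<bullet> \<beta>' - x \<bullet> \<beta>\<bar> / 2 \<le> e" and e0: "0 \<le> e"
    and C [measurable]: "C \<in> sets borel"
    and f: "f \<in> borel_measurable (PiM {0..<t} (\<lambda>_. round_space))"
      "\<And>h. h \<in> space (PiM {0..<t} (\<lambda>_. round_space)) \<Longrightarrow> f h \<le> (1::ennreal)"
  shows "(\<integral>\<^sup>+\<omega>. f (past t \<omega>) \<partial>trajectory_law \<beta>' \<pi>) \<le>
    (\<integral>\<^sup>+\<omega>. f (past t \<omega>) \<partial>trajectory_law \<beta> \<pi>) + ennreal (t * e)"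
  using f
proof (induction t arbitrary: f)
  case 0
  have const: "f (past 0 \<omega>) = f (\<lambda>_. undefined)" for \<omega>
    by (simp add: past_def restrict_def)
  show ?case
    using prob_space.emeasure_space_1[OF prob_space_trajectory_law[OF \<pi>]] by (simp add: const)
next
  case (Suc t)
  note [measurable] = Suc.prems(1)
  let ?M = "\<lambda>t. PiM {0..<t} (\<lambda>_. round_space :: ('a \<times> real) measure)"
  let ?k = "\<lambda>\<beta> h. \<integral>\<^sup>+z. f (h(t := z)) \<partial>round_kernel \<beta> \<pi> t h"
  note IT = Ionescu_Tulcea_round_kernel[OF \<pi>]
  interpret N: prob_space noise by (rule prob_space_noise)
  have k_meas: "?k \<beta> \<in> borel_measurable (?M t)" for \<beta>
    by (rule Ionescu_Tulcea.borel_measurable_nn_integral_P[OF IT]) fact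
  have step: "(\<integral>\<^sup>+\<omega>. f (past (Suc t) \<omega>) \<partial>trajectory_law \<beta> \<pi>) =
      (\<integral>\<^sup>+\<omega>. ?k \<beta> (past t \<omega>) \<partial>trajectory_law \<beta> \<pi>)" for \<beta>
    unfolding trajectory_law_def past_def by (rule Ionescu_Tulcea.nn_integral_lim_Suc[OF IT Suc.prems(1)])
  have upd: "(\<lambda>z. h(t := z)) \<in> round_space \<rightarrow>\<^sub>M ?M (Suc t)" if "h \<in> space (?M t)" for h
    by (rule measurable_fun_upd[where J="{0..<t}"]) (auto intro!: measurable_const that)
  have f1: "f (h(t := z)) \<le> 1" if "h \<in> space (?M t)" for h z
    using measurable_space[OF upd[OF that], of z] by (intro Suc.prems(2)) (simp add: space_pair_measure del: fun_upd_apply)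
  have k1: "?k \<beta>' h \<le> 1" if h: "h \<in> space (?M t)" for h
  proof -
    interpret K: prob_space "round_kernel \<beta>' \<pi> t h"
      by (rule Ionescu_Tulcea.prob_space_P[OF IT h])
    have "?k \<beta>' h \<le> (\<integral>\<^sup>+z. 1 \<partial>round_kernel \<beta>' \<pi> t h)"
      by (intro nn_integral_mono f1 h)
    then show ?thesis by (simp add: K.emeasure_space_1)
  qed
  \<comment> \<open>The integrals over the choice are with respect to the same
    \<open>\<pi> t h\<close>; the noise bound is applied for each fixed choice
    \<open>x \<in> C\<close>.\<close>
  have k_le: "?k \<beta>' h \<le> ?k \<beta> h + ennreal e" if h: "h \<in> space (?M t)" for h
  proof -
    interpret X: prob_space "\<pi> t h" by (rule is_policyD(2)[OF \<pi> h])
    note sets_X [measurable_cong] = is_policyD(3)[OF \<pi> h]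
    have fz [measurable]: "(\<lambda>z. f (h(t := z))) \<in> borel_measurable round_space"
      by (rule measurable_compose[OF upd[OF h] Suc.prems(1)])
    have "AE x in \<pi> t h. x \<in> C"
      using is_policyD(4)[OF \<pi> h] by (subst X.prob_eq_1[symmetric]) (auto simp: X.emeasure_eq_measure sets_X)
    moreover have "(\<integral>\<^sup>+\<eta>. f (h(t := (x, x \<bullet> \<beta>' + \<eta>))) \<partial>noise) \<le>
        (\<integral>\<^sup>+\<eta>. f (h(t := (x, x \<bullet> \<beta> + \<eta>))) \<partial>noise) + ennreal e" if "x \<in> C" for x
      using nn_integral_noise_shift_le[of "\<lambda>y. f (h(t := (x, y)))" "x \<bullet> \<beta>'" "x \<bullet> \<beta>"] f1[OF h]
        ennreal_leI[OF e[OF that]]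
      by (auto intro: order_trans add_left_mono)
    ultimately have "(\<integral>\<^sup>+x. (\<integral>\<^sup>+\<eta>. f (h(t := (x, x \<bullet> \<beta>' + \<eta>))) \<partial>noise) \<partial>\<pi> t h) \<le>
        (\<integral>\<^sup>+x. (\<integral>\<^sup>+\<eta>. f (h(t := (x, x \<bullet> \<beta> + \<eta>))) \<partial>noise) + ennreal e \<partial>\<pi> t h)"
      by (intro nn_integral_mono_AE) (auto elim: eventually_mono)
    also have "\<dots> = (\<integral>\<^sup>+x. (\<integral>\<^sup>+\<eta>. f (h(t := (x, x \<bullet> \<beta> + \<eta>))) \<partial>noise) \<partial>\<pi> t h) + (\<integral>\<^sup>+x. ennreal e \<partial>\<pi> t h)"
      by (intro nn_integral_add N.borel_measurable_nn_integral) measurable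
    finally show ?thesis
      unfolding nn_integral_round_kernel[OF \<pi> h fz] by (simp add: X.emeasure_space_1)
  qed
  interpret L: prob_space "trajectory_law \<beta> \<pi>" by (rule prob_space_trajectory_law[OF \<pi>])
  have k_past: "(\<lambda>\<omega>. ?k \<beta> (past t \<omega>)) \<in> borel_measurable (trajectory_law \<beta> \<pi>)"
    using measurable_compose[OF measurable_past k_meas]
    by (simp add: measurable_cong_sets[OF sets_trajectory_law[OF \<pi>] refl])
  have "(\<integral>\<^sup>+\<omega>. ?k \<beta>' (past t \<omega>) \<partial>trajectory_law \<beta> \<pi>) \<le>
      (\<integral>\<^sup>+\<omega>. ?k \<beta> (past t \<omega>) + ennreal e \<partial>trajectory_law \<beta> \<pi>)"
    by (intro nn_integral_mono k_le past_in_space)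
  also have "\<dots> = (\<integral>\<^sup>+\<omega>. ?k \<beta> (past t \<omega>) \<partial>trajectory_law \<beta> \<pi>) + ennreal e"
    by (subst nn_integral_add[OF k_past]) (auto simp: L.emeasure_space_1)
  finally have k: "(\<integral>\<^sup>+\<omega>. ?k \<beta>' (past t \<omega>) \<partial>trajectory_law \<beta> \<pi>) \<le>
      (\<integral>\<^sup>+\<omega>. ?k \<beta> (past t \<omega>) \<partial>trajectory_law \<beta> \<pi>) + ennreal e" .
  have "(\<integral>\<^sup>+\<omega>. ?k \<beta>' (past t \<omega>) \<partial>trajectory_law \<beta>' \<pi>) \<le>
      (\<integral>\<^sup>+\<omega>. ?k \<beta>' (past t \<omega>) \<partial>trajectory_law \<beta> \<pi>) + ennreal (t * e)"
    by (rule Suc.IH[OF k_meas k1])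
  \<comment> \<open>The induction hypothesis has changed the instance in the first \<open>t\<close>
    rounds, with round \<open>t\<close> averaged under \<open>\<beta>'\<close>. Now round
    \<open>t\<close> is changed as well.\<close>
  also have "\<dots> \<le> (\<integral>\<^sup>+\<omega>. ?k \<beta> (past t \<omega>) \<partial>trajectory_law \<beta> \<pi>) + ennreal e + ennreal (t * e)"
    by (rule add_right_mono[OF k])
  also have "\<dots> = (\<integral>\<^sup>+\<omega>. ?k \<beta> (past t \<omega>) \<partial>trajectory_law \<beta> \<pi>) + ennreal (Suc t * e)"
    using e0 by (simp add: add.assoc distrib_right flip: ennreal_plus)
  finally show ?case
    unfolding step .
qed

text \<open>Given a past in \<open>H\<close>, the next choice falls into \<open>A\<close> with
  probability at most \<open>r\<close>; the bound persists when averaged over the past.\<close>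

lemma prob_choice_le:
  fixes \<pi> :: "'a::euclidean_space policy"
  assumes \<pi>: "is_policy C \<pi>" and A [measurable]: "A \<in> sets borel"
    and H [measurable]: "H \<in> sets (PiM {0..<t} (\<lambda>_. round_space))"
    and r: "\<And>h. h \<in> H \<Longrightarrow> measure (\<pi> t h) A \<le> r" and r0: "0 \<le> r"
  shows "measure (trajectory_law \<beta> \<pi>) {\<omega>. past t \<omega> \<in> H \<and> fst (\<omega> t) \<in> A} \<le> r"
proof -
  let ?M = "\<lambda>t. PiM {0..<t} (\<lambda>_. round_space :: ('a \<times> real) measure)"
  interpret L: prob_space "trajectory_law \<beta> \<pi>" by (rule prob_space_trajectory_law[OF \<pi>])
  define f where "f h = indicator H (restrict h {0..<t}) * (indicator A (fst (h t)) :: ennreal)" for h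
  have [measurable]: "(\<lambda>h. restrict h {0..<t}) \<in> ?M (Suc t) \<rightarrow>\<^sub>M ?M t"
    by (rule measurable_restrict_subset) auto
  have [measurable]: "(\<lambda>h. h t) \<in> ?M (Suc t) \<rightarrow>\<^sub>M round_space"
    by (rule measurable_component_singleton) auto
  have f: "f \<in> borel_measurable (?M (Suc t))"
    unfolding f_def by measurable
  interpret N: prob_space noise by (rule prob_space_noise)
  have ev: "{\<omega>. past t \<omega> \<in> H \<and> fst (\<omega> t) \<in> A} \<in> sets (trajectory_law \<beta> \<pi>)"
    by (rule sets_trajectory_law_choice[OF \<pi> A H])
  have "emeasure (trajectory_law \<beta> \<pi>) {\<omega>. past t \<omega> \<in> H \<and> fst (\<omega> t) \<in> A} =
      (\<integral>\<^sup>+\<omega>. indicator {\<omega>. past t \<omega> \<in> H \<and> fst (\<omega> t) \<in> A} \<omega> \<partial>trajectory_law \<beta> \<pi>)"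
    using ev by simp
  also have "\<dots> = (\<integral>\<^sup>+\<omega>. f (past (Suc t) \<omega>) \<partial>trajectory_law \<beta> \<pi>)"
    by (intro nn_integral_cong) (auto simp: f_def past_def Int_absorb1 split: split_indicator)
  also have "\<dots> = (\<integral>\<^sup>+\<omega>. (\<integral>\<^sup>+x. (\<integral>\<^sup>+\<eta>. f ((past t \<omega>)(t := (x, x \<bullet> \<beta> + \<eta>))) \<partial>noise) \<partial>\<pi> t (past t \<omega>))
      \<partial>trajectory_law \<beta> \<pi>)"
    by (rule nn_integral_trajectory_law_Suc[OF \<pi> f])
  also have "\<dots> = (\<integral>\<^sup>+\<omega>. (\<integral>\<^sup>+x. indicator H (past t \<omega>) * indicator A x \<partial>\<pi> t (past t \<omega>)) \<partial>trajectory_law \<beta> \<pi>)"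
  proof (intro nn_integral_cong)
    fix \<omega> :: "'a trajectory" and x
    \<comment> \<open>Writing round \<open>t\<close> leaves the earlier rounds alone, and the event
      does not look at the observation, so the noise integrates to 1.\<close>
    have "restrict ((past t \<omega>)(t := z)) {0..<t} = past t \<omega>" for z :: "'a \<times> real"
      by (auto simp: past_def)
    then show "(\<integral>\<^sup>+\<eta>. f ((past t \<omega>)(t := (x, x \<bullet> \<beta> + \<eta>))) \<partial>noise) =
        indicator H (past t \<omega>) * indicator A x"
      using N.emeasure_space_1 by (simp add: f_def)
  qed
  also have "\<dots> \<le> (\<integral>\<^sup>+\<omega>. ennreal r \<partial>trajectory_law \<beta> \<pi>)"
  proof (rule nn_integral_mono)
    fix \<omega>
    show "(\<integral>\<^sup>+x. indicator H (past t \<omega>) * indicator A x \<partial>\<pi> t (past t \<omega>)) \<le> ennreal r"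
    proof (cases "past t \<omega> \<in> H")
      case True
      interpret X: prob_space "\<pi> t (past t \<omega>)" by (rule is_policyD(2)[OF \<pi> past_in_space])
      have "(\<integral>\<^sup>+x. indicator H (past t \<omega>) * indicator A x \<partial>\<pi> t (past t \<omega>)) = emeasure (\<pi> t (past t \<omega>)) A"
        using True is_policyD(3)[OF \<pi> past_in_space] by simp
      then show ?thesis
        using r[OF True] by (simp add: X.emeasure_eq_measure ennreal_leI)
    qed simp
  qed
  finally show ?thesis
    using r0 by (simp add: L.emeasure_eq_measure L.prob_space)
qed

text \<open>Markov's inequality for the number of events that occur, whose expectation is at most
  \<open>m * r\<close>.\<close>

lemma (in prob_space) prob_half_of_events_le:
  fixes B :: "nat \<Rightarrow> 'a set"
  assumes B: "\<And>t. t < m \<Longrightarrow> B t \<in> events" and r: "\<And>t. t < m \<Longrightarrow> prob (B t) \<le> r" and m: "0 < m"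
  shows "prob {x \<in> space M. real m / 2 \<le> (\<Sum>t<m. indicator (B t) x)} \<le> 2 * r"
proof -
  have int: "integrable M (\<lambda>x. \<Sum>t<m. indicator (B t) x :: real)"
    using B by (intro Bochner_Integration.integrable_sum) (auto simp: emeasure_eq_measure)
  have "prob {x \<in> space M. real m / 2 \<le> (\<Sum>t<m. indicator (B t) x)} \<le>
      (\<integral>x. (\<Sum>t<m. indicator (B t) x) \<partial>M) / (real m / 2)"
    using m int by (intro integral_Markov_inequality_measure[where A="{}"]) (auto intro: sum_nonneg)
  also have "(\<integral>x. (\<Sum>t<m. indicator (B t) x :: real) \<partial>M) = (\<Sum>t<m. prob (B t))"
    using B by (subst Bochner_Integration.integral_sum) (auto simp: emeasure_eq_measure)
  also have "\<dots> / (real m / 2) \<le> (m * r) / (real m / 2)"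
    using sum_bounded_above[of "{..<m}" "\<lambda>t. prob (B t)" r] r m by (intro divide_right_mono) auto
  also have "\<dots> = 2 * r" using m by simp
  finally show ?thesis .
qed

subsection \<open>Gap and regret in the cube\<close>

abbreviation tilted :: "'n::finite \<Rightarrow> real \<Rightarrow> real ^ 'n" where
  "tilted q s \<equiv> \<chi> i. if i = q then s else 1"

lemma inner_vec_sum: "x \<bullet> y = (\<Sum>i\<in>UNIV. x $ i * y $ i)" for x y :: "real ^ 'n::finite"
  by (simp add: inner_vec_def)

lemma one_in_cube: "1 \<in> cube" by (simp add: cube_def)

text \<open>The inner product with \<open>1 - x\<close> is a sum of nonnegative terms, so each
  single term is a lower bound. This gives the maximizer, the gap and the regret.\<close>

lemma cube_inner_le_one:
  fixes \<beta> x :: "real ^ 'n::finite"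
  assumes "\<And>i. 0 \<le> \<beta> $ i" "x \<in> cube"
  shows "\<beta> $ i * (1 - x $ i) \<le> \<beta> \<bullet> (1 - x)"
proof -
  have "\<beta> $ i * (1 - x $ i) \<le> (\<Sum>i\<in>UNIV. \<beta> $ i * (1 - x) $ i)"
    using assms member_le_sum[of i UNIV "\<lambda>i. \<beta> $ i * (1 - x) $ i"]
    by (auto simp: cube_def)
  then show ?thesis by (simp add: inner_vec_sum)
qed

text \<open>A coordinate strictly between -1 and 1 can be moved both ways by the same amount, which
  makes \<open>x\<close> the midpoint of a segment in the cube.\<close>

lemma extreme_point_of_cube:
  assumes "x extreme_point_of cube"
  shows "x $ i = 1 \<or> x $ i = - 1"
proof (rule ccontr)
  assume n: "\<not> (x $ i = 1 \<or> x $ i = - 1)"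
  have x: "x \<in> cube" using assms by (simp add: extreme_point_of_def)
  then have xj: "- 1 \<le> x $ j" "x $ j \<le> 1" for j by (auto simp: cube_def)
  define e where "e = min (1 - x $ i) (x $ i + 1)"
  have e: "0 < e" using n xj[of i] by (auto simp: e_def)
  have e_le: "e \<le> 1 - x $ i" "e \<le> x $ i + 1" by (auto simp: e_def)
  have nth: "(x + axis i e) $ j = (if j = i then x $ i + e else x $ j)"
    "(x - axis i e) $ j = (if j = i then x $ i - e else x $ j)" for j
    by (auto simp: axis_def)
  have "x + axis i e \<in> cube" "x - axis i e \<in> cube"
    unfolding cube_def mem_Collect_eq nth using xj xj[of i] e e_le by auto
  moreover have "x \<in> open_segment (x + axis i e) (x - axis i e)"
  proof -
    have "x + axis i e \<noteq> x - axis i e"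
      using e nth[of i] by (auto dest: arg_cong[where f="\<lambda>v. v $ i"])
    moreover have "midpoint (x + axis i e) (x - axis i e) = x"
      by (simp add: midpoint_def flip: scaleR_2)
    ultimately show ?thesis
      using midpoint_in_open_segment by metis
  qed
  ultimately show False
    using assms by (auto simp: extreme_point_of_def)
qed

text \<open>This makes the set under the infimum in the gap nonempty. Every coordinate is minimal at
  -1, so a proper convex combination attains it only if both end points do.\<close>

lemma minus_one_extreme_point_of_cube: "- 1 extreme_point_of (cube :: (real ^ 'n::finite) set)"
  unfolding extreme_point_of_def
proof (intro conjI ballI notI)
  fix a b :: "real ^ 'n"
  assume ab: "a \<in> cube" "b \<in> cube" "- 1 \<in> open_segment a b"
  then obtain u where u: "0 < u" "u < 1" "- 1 = (1 - u) *\<^sub>R a + u *\<^sub>R b" and "a \<noteq> b"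
    by (auto simp: in_segment)
  have bounds: "- 1 \<le> a $ i" "- 1 \<le> b $ i" for i
    using ab by (auto simp: cube_def)
  have "a $ i = b $ i" for i
  proof -
    have "- 1 = (1 - u) * a $ i + u * b $ i"
      using arg_cong[OF u(3), of "\<lambda>v. v $ i"] by simp
    then have eq: "(1 - u) * (a $ i + 1) + u * (b $ i + 1) = 0" by (simp add: algebra_simps)
    moreover have "0 \<le> (1 - u) * (a $ i + 1)" "0 \<le> u * (b $ i + 1)"
      using u(1,2) bounds[of i] by auto
    ultimately have "(1 - u) * (a $ i + 1) = 0" "u * (b $ i + 1) = 0" by linarith+
    then show ?thesis using u by simp
  qed
  with \<open>a \<noteq> b\<close> show False by (simp add: vec_eq_iff)
qed (simp add: cube_def)

text \<open>All entries are positive, so 1 is the only maximizer. Another vertex has some entry -1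
  and loses at least twice the entry of the instance there, which is \<open>s\<close> or 1.\<close>

lemma gap_tilted_ge:
  assumes s: "0 < s" "s \<le> 1"
  shows "2 * s \<le> gap cube (tilted q s :: real ^ 'n::finite)"
proof -
  let ?\<beta> = "tilted q s :: real ^ 'n"
  have nn: "0 \<le> ?\<beta> $ i" for i using s by simp
  \<comment> \<open>\<open>arg_max_on\<close> selects an arbitrary maximizer, so uniqueness has to
    be shown as well.\<close>
  have "arg_max_on (\<lambda>x. ?\<beta> \<bullet> x) cube = 1"
    unfolding arg_max_on_def
  proof (rule arg_maxI[where x=1])
    show "\<not> ?\<beta> \<bullet> 1 < ?\<beta> \<bullet> x" if "x \<in> cube" for x
    proof -
      have "0 \<le> ?\<beta> $ q * (1 - x $ q)" using nn[of q] that by (auto simp: cube_def)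
      with cube_inner_le_one[of ?\<beta> x q] nn that show ?thesis by (simp add: inner_diff_right)
    qed
    show "x = 1" if x: "x \<in> cube" "\<forall>y. y \<in> cube \<longrightarrow> \<not> ?\<beta> \<bullet> x < ?\<beta> \<bullet> y" for x
    proof -
      have "1 - x $ i \<le> 0" for i
      proof -
        have "?\<beta> $ i * (1 - x $ i) \<le> ?\<beta> \<bullet> (1 - x)"
          using nn x by (intro cube_inner_le_one) auto
        also have "\<dots> \<le> 0" using x(2) one_in_cube by (auto simp: inner_diff_right not_less)
        finally show ?thesis using s by (auto simp: mult_le_0_iff split: if_splits)
      qed
      with x(1) show ?thesis by (auto simp: vec_eq_iff cube_def intro!: antisym)
    qed
  qed (rule one_in_cube)
  moreover have "2 * s \<le> (INF x\<in>{x. x extreme_point_of cube \<and> x \<noteq> 1}. ?\<beta> \<bullet> (1 - x))"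
  proof (rule cINF_greatest)
    have "(- 1 :: real ^ 'n) \<noteq> 1" by (simp add: vec_eq_iff)
    with minus_one_extreme_point_of_cube
    show "{x :: real ^ 'n. x extreme_point_of cube \<and> x \<noteq> 1} \<noteq> {}" by blast
  next
    fix x :: "real ^ 'n" assume x: "x \<in> {x. x extreme_point_of cube \<and> x \<noteq> 1}"
    then obtain i where "x $ i \<noteq> 1" by (auto simp: vec_eq_iff)
    with x extreme_point_of_cube[of x i] have i: "x $ i = - 1" by auto
    have "2 * s \<le> ?\<beta> $ i * (1 - x $ i)" using s by (simp add: i)
    also have "\<dots> \<le> ?\<beta> \<bullet> (1 - x)"
      using x nn by (intro cube_inner_le_one) (auto simp: extreme_point_of_def)
    finally show "2 * s \<le> ?\<beta> \<bullet> (1 - x)" .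
  qed
  ultimately show ?thesis by (simp add: gap_def)
qed

lemma regret_cube_ge:
  fixes \<beta> :: "real ^ 'n::finite"
  assumes \<beta>: "\<And>i. 0 \<le> \<beta> $ i" "\<beta> $ p = 1" and \<omega>: "\<And>t. fst (\<omega> t) \<in> cube" and m: "m \<le> T"
  shows "(\<Sum>t<m. 1 - fst (\<omega> t) $ p) \<le> regret cube \<beta> \<omega> T"
proof -
  have le: "\<beta> \<bullet> x \<le> \<beta> \<bullet> 1 - (1 - x $ p)" if "x \<in> cube" for x
    using cube_inner_le_one[of \<beta> x p] that \<beta> by (simp add: inner_diff_right)
  have "bdd_above ((\<lambda>x. \<beta> \<bullet> x) ` cube)"
  proof (rule bdd_aboveI2)
    show "\<beta> \<bullet> x \<le> \<beta> \<bullet> 1" if "x \<in> cube" for x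
      using le[OF that] that by (auto simp: cube_def dest: spec[of _ p])
  qed
  then have sup: "\<beta> \<bullet> 1 \<le> (SUP x\<in>cube. \<beta> \<bullet> x)"
    by (intro cSUP_upper one_in_cube)
  have "(\<Sum>t<m. 1 - fst (\<omega> t) $ p) \<le> (\<Sum>t<T. 1 - fst (\<omega> t) $ p)"
    using m \<omega> by (intro sum_mono2) (auto simp: cube_def)
  also have "\<dots> \<le> regret cube \<beta> \<omega> T"
    unfolding regret_def using le[OF \<omega>] sup by (intro sum_mono) (smt (verit))
  finally show ?thesis .
qed

subsection \<open>The lower bound\<close>

lemma measurable_policy_measure:
  assumes "is_policy C \<pi>" "A \<in> sets borel"
  shows "(\<lambda>h. measure (\<pi> t h) A) \<in> borel_measurable (PiM {0..<t} (\<lambda>_. round_space))"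
  by (rule measurable_compose[OF measurable_prob_algebraD[OF is_policyD(1)[OF assms(1)]]
    measurable_measure_subprob_algebra[OF assms(2)]])

lemma measurable_past_initial:
  assumes "s \<le> t"
  shows "past s \<in> PiM {0..<t} (\<lambda>_. round_space) \<rightarrow>\<^sub>M PiM {0..<s} (\<lambda>_. round_space)"
  unfolding past_def[abs_def] by (rule measurable_restrict_subset) (use assms in auto)

text \<open>The total variation bound for events that are determined by the first \<open>t\<close>
  rounds.\<close>

lemma prob_past_le:
  fixes \<pi> :: "'a::euclidean_space policy"
  assumes \<pi>: "is_policy C \<pi>" and e: "\<And>x. x \<in> C \<Longrightarrow> \<bar>x \<bullet> \<beta>' - x \<bullet> \<beta>\<bar> / 2 \<le> e" "0 \<le> e"
    and C: "C \<in> sets borel" and G: "G \<in> sets (PiM {0..<t} (\<lambda>_. round_space))"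
  shows "measure (trajectory_law \<beta>' \<pi>) {\<omega>. past t \<omega> \<in> G} \<le>
    measure (trajectory_law \<beta> \<pi>) {\<omega>. past t \<omega> \<in> G} + t * e"
proof -
  interpret A: prob_space "trajectory_law b \<pi>" for b by (rule prob_space_trajectory_law[OF \<pi>])
  have ev: "{\<omega>. past t \<omega> \<in> G} \<in> sets (trajectory_law \<beta> \<pi>)" for \<beta>
    using sets_trajectory_law_choice[OF \<pi> _ G, of UNIV \<beta>] by simp
  have eq: "(\<integral>\<^sup>+\<omega>. indicator G (past t \<omega>) \<partial>trajectory_law \<beta> \<pi>) =
      ennreal (measure (trajectory_law \<beta> \<pi>) {\<omega>. past t \<omega> \<in> G})" for \<beta>
  proof -
    have "(\<integral>\<^sup>+\<omega>. indicator G (past t \<omega>) \<partial>trajectory_law \<beta> \<pi>) =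
        (\<integral>\<^sup>+\<omega>. indicator {\<omega>. past t \<omega> \<in> G} \<omega> \<partial>trajectory_law \<beta> \<pi>)"
      by (intro nn_integral_cong) (simp split: split_indicator)
    then show ?thesis using ev by (simp add: A.emeasure_eq_measure)
  qed
  have "(\<integral>\<^sup>+\<omega>. indicator G (past t \<omega>) \<partial>trajectory_law \<beta>' \<pi>) \<le>
      (\<integral>\<^sup>+\<omega>. indicator G (past t \<omega>) \<partial>trajectory_law \<beta> \<pi>) + ennreal (t * e)"
  proof (rule nn_integral_trajectory_law_le[where f="indicator G" and t=t and C=C])
    show "is_policy C \<pi>" "0 \<le> e" "C \<in> sets borel" by fact+
    show "\<bar>x \<bullet> \<beta>' - x \<bullet> \<beta>\<bar> / 2 \<le> e" if "x \<in> C" for x using that by (rule e)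
  qed (use G in \<open>auto split: split_indicator\<close>)
  then show ?thesis
    using e(2) by (simp add: eq flip: ennreal_plus)
qed

text \<open>The losses are \<open>\<delta>\<close> for fairness under each of the two instances,
  \<open>l * s\<close> for the change of instance and \<open>2 / N\<close> for Markov's inequality.
  On the remaining event more than half of the \<open>Suc l\<close> rounds cost at least
  \<open>1 / N\<close> each.\<close>

lemma prob_regret_tilted_ge:
  fixes \<A> :: "real \<Rightarrow> (real ^ 'n::finite) policy" and s :: real and N l T :: nat
  assumes pq: "p \<noteq> (q :: 'n)" and s: "0 < s" "s \<le> 1"
    and fair: "fair_algorithm cube cube \<A>" and \<delta>: "\<delta> \<in> {0<..1}"
    and N: "0 < N" and l: "l < T"
  defines "\<mu> \<equiv> trajectory_law (tilted q s) (\<A> \<delta>)"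
  shows "1 - 2 * \<delta> - l * s - 2 / N \<le>
    measure \<mu> {\<omega> \<in> space \<mu>. Suc l / (2 * N) \<le> regret cube (tilted q s) \<omega> T}"
proof -
  let ?\<pi> = "\<A> \<delta>" and ?\<beta> = "tilted q s" and ?\<beta>' = "tilted q (- s)"
  let ?M = "\<lambda>t. PiM {0..<t} (\<lambda>_. round_space :: ((real ^ 'n) \<times> real) measure)"

  \<comment> \<open>The two translations\<close>
  obtain K :: nat where K: "1 / s \<le> K" using real_arch_simple by blast
  have "0 < 1 / s" using s by simp
  with K have K0: "0 < K" by (cases K) auto
  define b where "b = 1 / (2 * real N * real K)"
  \<comment> \<open>With this \<open>c\<close> the vector \<open>u\<close> is orthogonal to the
    instance with entry \<open>s\<close>, and \<open>d\<close> to the one with entry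
    \<open>- s\<close>. The choice \<open>K \<ge> 1 / s\<close> makes the steps so small that
    \<open>c \<le> 1\<close>.\<close>
  define c where "c = b / s"
  define u :: "real ^ 'n" where "u = (\<chi> i. if i = p then - b else if i = q then c else 0)"
  define d :: "real ^ 'n" where "d = (\<chi> i. if i = p then - b else if i = q then - c else 0)"
  define F where "F = {A \<in> test_sets p q u (1 / N) b (N * K). A \<subseteq> cube \<and> (+) d ` A \<subseteq> cube}"
  have c: "0 \<le> c" "c \<le> 1"
  proof -
    show "0 \<le> c" using s by (simp add: c_def b_def)
    have "1 * 1 \<le> (2 * real N) * (real K * s)"
      using K N s by (intro mult_mono) (auto simp: field_simps)
    then show "c \<le> 1" using s N K0 by (simp add: c_def b_def field_simps)
  qed
  have inner: "tilted q r \<bullet> v = v $ p + r * v $ q" if "\<And>i. i \<noteq> p \<Longrightarrow> i \<noteq> q \<Longrightarrow> v $ i = 0"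
    for r and v :: "real ^ 'n"
  proof -
    have "tilted q r \<bullet> v = (\<Sum>i\<in>{p, q}. tilted q r $ i * v $ i)"
      unfolding inner_vec_sum using that by (intro sum.mono_neutral_right) auto
    then show ?thesis using pq by simp
  qed
  have u0: "0 \<le> ?\<beta> \<bullet> u" and d0: "0 \<le> ?\<beta>' \<bullet> d"
    using s pq by (subst inner; simp add: u_def d_def c_def)+
  have [measurable]: "cube \<in> sets borel" unfolding cube_def by measurable
  have \<beta>_cube: "?\<beta> \<in> cube" "?\<beta>' \<in> cube" using s by (auto simp: cube_def)
  have \<pi>: "is_policy cube ?\<pi>"
    using fair \<delta> by (auto simp: fair_algorithm_def)
  have "\<forall>\<beta>\<in>cube. \<exists>E \<in> sets (trajectory_law \<beta> ?\<pi>). measure (trajectory_law \<beta> ?\<pi>) E \<ge> 1 - \<delta> \<and>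
      (\<forall>\<omega>\<in>E. \<forall>t. fair_distribution cube \<beta> (?\<pi> t (past t \<omega>)))"
    using fair \<delta> by (auto simp: fair_algorithm_def)
  with \<beta>_cube obtain E E' where E: "E \<in> sets \<mu>" "1 - \<delta> \<le> measure \<mu> E"
      "\<And>\<omega> t. \<omega> \<in> E \<Longrightarrow> fair_distribution cube ?\<beta> (?\<pi> t (past t \<omega>))"
    and E': "1 - \<delta> \<le> measure (trajectory_law ?\<beta>' ?\<pi>) E'"
      "\<And>\<omega> t. \<omega> \<in> E' \<Longrightarrow> fair_distribution cube ?\<beta>' (?\<pi> t (past t \<omega>))"
    unfolding \<mu>_def by meson
  interpret L: prob_space \<mu> unfolding \<mu>_def by (rule prob_space_trajectory_law[OF \<pi>])
  interpret L': prob_space "trajectory_law ?\<beta>' ?\<pi>" by (rule prob_space_trajectory_law[OF \<pi>])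
  have space_L: "space \<mu> = UNIV" unfolding \<mu>_def by (rule space_trajectory_law[OF \<pi>])

  \<comment> \<open>Transfer of fairness from the second instance to the first\<close>
  define H' where "H' t = {h \<in> space (?M t). \<forall>A\<in>F. measure (?\<pi> t h) A \<le> measure (?\<pi> t h) ((+) d ` A)}" for t
  have "F \<subseteq> test_sets p q u (1 / N) b (N * K)" by (auto simp: F_def)
  then have F: "finite F" "\<And>A. A \<in> F \<Longrightarrow> A \<in> sets borel"
    by (blast intro: finite_subset finite_test_sets test_sets_borel)+
  have H': "H' t \<in> sets (?M t)" for t
    unfolding H'_def
    by (intro sets.sets_Collect_finite_All borel_measurable_le measurable_policy_measure[OF \<pi>]
      sets_borel_translation F) auto
  \<comment> \<open>The choice in round \<open>l\<close> depends only on the \<open>l\<close> rounds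
    before it, so \<open>l\<close> observations settle the tests for the \<open>Suc l\<close> rounds
    up to \<open>l\<close>.\<close>
  define G where "G = {h \<in> space (?M l). \<forall>t\<in>{..l}. past t h \<in> H' t}"
  have G: "G \<in> sets (?M l)"
    unfolding G_def
  proof (intro sets.sets_Collect_finite_All)
    fix t assume "t \<in> {..l}"
    then have "past t -` H' t \<inter> space (?M l) \<in> sets (?M l)"
      by (intro measurable_sets[OF measurable_past_initial H']) simp
    then show "{h \<in> space (?M l). past t h \<in> H' t} \<in> sets (?M l)"
      by (simp add: vimage_def Int_def conj_commute)
  qed simp
  have past_G: "past t \<omega> \<in> H' t" if "past l \<omega> \<in> G" "t \<le> l" for \<omega> t
    using that by (auto simp: G_def past_past)
  have evG: "{\<omega>. past l \<omega> \<in> G} \<in> sets (trajectory_law \<beta> ?\<pi>)" for \<beta>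
    using sets_trajectory_law_choice[OF \<pi> _ G, of UNIV \<beta>] by simp
  have "E' \<subseteq> {\<omega>. past l \<omega> \<in> G}"
  proof
    fix \<omega> assume "\<omega> \<in> E'"
    then have "past t \<omega> \<in> H' t" for t
      unfolding H'_def using fair_distribution_shift[OF E'(2) F(2) _ _ d0]
      by (auto simp: past_in_space F_def)
    then show "\<omega> \<in> {\<omega>. past l \<omega> \<in> G}"
      by (auto simp: G_def past_in_space past_past)
  qed
  then have "1 - \<delta> \<le> measure (trajectory_law ?\<beta>' ?\<pi>) {\<omega>. past l \<omega> \<in> G}"
    using E'(1) L'.finite_measure_mono[OF _ evG] by (meson order_trans)
  also have "\<dots> \<le> measure \<mu> {\<omega>. past l \<omega> \<in> G} + l * s"
    unfolding \<mu>_def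
  proof (rule prob_past_le[OF \<pi> _ _ _ G])
    fix x :: "real ^ 'n" assume x: "x \<in> cube"
    \<comment> \<open>The instances differ by \<open>2 * s\<close> in one entry, and a coordinate in
      the cube is at most 1 in absolute value.\<close>
    have "x \<bullet> ?\<beta>' - x \<bullet> ?\<beta> = (?\<beta>' - ?\<beta>) \<bullet> x"
      by (simp only: inner_diff_left inner_commute[of x])
    also have "?\<beta>' - ?\<beta> = axis q (- 2 * s)"
      by (simp add: vec_eq_iff axis_def)
    also have "\<dots> \<bullet> x = - 2 * s * x $ q"
      by (simp add: inner_axis')
    finally have "\<bar>x \<bullet> ?\<beta>' - x \<bullet> ?\<beta>\<bar> / 2 = s * \<bar>x $ q\<bar>"
      using s by (simp add: abs_mult)
    also have "\<dots> \<le> s" using x s by (intro mult_left_le) (auto simp: cube_def abs_le_iff minus_le_iff)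
    finally show "\<bar>x \<bullet> ?\<beta>' - x \<bullet> ?\<beta>\<bar> / 2 \<le> s" .
  qed (use s in auto)
  finally have prob_G: "1 - \<delta> - l * s \<le> measure \<mu> {\<omega>. past l \<omega> \<in> G}" by simp

  \<comment> \<open>Rounds that respect both instances\<close>
  define top where "top = {x :: real ^ 'n. 1 - 1 / N < x $ p}"
  have [measurable]: "top \<in> sets borel" unfolding top_def by measurable
  define H where "H t = {h \<in> space (?M t). measure (?\<pi> t h) top \<le> 1 / N}" for t
  have H: "H t \<in> sets (?M t)" for t
    unfolding H_def by (intro borel_measurable_le measurable_policy_measure[OF \<pi>]) auto
  \<comment> \<open>Fairness under the first instance supplies the translations by \<open>u\<close>,
    and membership in \<open>G\<close> those by \<open>d\<close>.\<close>
  have past_H: "past t \<omega> \<in> H t" if "\<omega> \<in> E" "past l \<omega> \<in> G" "t \<le> l" for \<omega> t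
  proof -
    let ?P = "?\<pi> t (past t \<omega>)"
    have "measure ?P top \<le> 1 / N"
      unfolding top_def
    proof (rule top_slab_le[OF is_policyD(2)[OF \<pi> past_in_space] is_policyD(3)[OF \<pi> past_in_space]
        is_policyD(4)[OF \<pi> past_in_space] pq N K0 c])
      show "measure ?P A \<le> measure ?P ((+) u ` A)"
        if "A \<in> sets borel" "A \<subseteq> cube" "(+) u ` A \<subseteq> cube" for A
        using fair_distribution_shift[OF E(3)[OF \<open>\<omega> \<in> E\<close>] that u0] .
      show "measure ?P A \<le> measure ?P ((+) d ` A)"
        if "A \<in> test_sets p q u (1 / N) (1 / (2 * real N * real K)) (N * K)" "A \<subseteq> cube" "(+) d ` A \<subseteq> cube" for A
        using that past_G[OF \<open>past l \<omega> \<in> G\<close> \<open>t \<le> l\<close>] by (auto simp: H'_def F_def b_def)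
    qed (auto simp: u_def d_def b_def)
    then show ?thesis by (simp add: H_def past_in_space)
  qed

  \<comment> \<open>Cheap rounds are rare\<close>
  define B where "B t = {\<omega>. past t \<omega> \<in> H t \<and> fst (\<omega> t) \<in> top}" for t
  have B: "B t \<in> L.events" for t
    unfolding B_def \<mu>_def by (rule sets_trajectory_law_choice[OF \<pi> _ H]) simp
  \<comment> \<open>Membership of the past in \<open>H t\<close> is part of the event, so nothing
    has to be conditioned on \<open>E\<close>, which may depend on the whole trajectory.\<close>
  have prob_B: "L.prob (B t) \<le> 1 / N" for t
    unfolding B_def \<mu>_def by (rule prob_choice_le[OF \<pi> _ H]) (auto simp: H_def)
  let ?many = "{\<omega> \<in> space \<mu>. real (Suc l) / 2 \<le> (\<Sum>t<Suc l. indicator (B t) \<omega>)}"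
  have many: "L.prob ?many \<le> 2 * (1 / N)"
    by (rule L.prob_half_of_events_le) (use B prob_B in auto)
  have [measurable]: "(\<lambda>\<omega>. fst (\<omega> t)) \<in> borel_measurable \<mu>" for t
    unfolding \<mu>_def by (rule measurable_trajectory_law[OF \<pi>])
  have many_ev: "?many \<in> L.events" using B by measurable
  have ev: "{\<omega> \<in> space \<mu>. Suc l / (2 * N) \<le> regret cube ?\<beta> \<omega> T} \<in> L.events"
    unfolding regret_def by measurable
  have in_cube: "AE \<omega> in \<mu>. \<forall>t. fst (\<omega> t) \<in> cube"
  proof (subst AE_all_countable, intro allI)
    fix t
    have "L.prob {\<omega>. past t \<omega> \<in> space (?M t) \<and> fst (\<omega> t) \<in> - cube} \<le> 0"
      unfolding \<mu>_def
    proof (rule prob_choice_le[OF \<pi>])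
      fix h assume h: "h \<in> space (?M t)"
      interpret X: prob_space "?\<pi> t h" by (rule is_policyD(2)[OF \<pi> h])
      show "measure (?\<pi> t h) (- cube) \<le> 0"
        using is_policyD(3,4)[OF \<pi> h] X.prob_compl[of cube]
        by (simp add: X.emeasure_eq_measure sets_eq_imp_space_eq[of _ borel] Compl_eq_Diff_UNIV)
    qed auto
    then have "L.prob {\<omega>. fst (\<omega> t) \<in> - cube} = 0"
      by (simp add: past_in_space measure_le_0_iff)
    moreover have "{\<omega>. fst (\<omega> t) \<in> - cube} \<in> L.events"
      using sets_trajectory_law_choice[OF \<pi>, of "- cube" "space (?M t)" t]
      by (simp add: past_in_space \<mu>_def)
    ultimately show "AE \<omega> in \<mu>. fst (\<omega> t) \<in> cube"
      by (subst AE_iff_measurable[where N="{\<omega>. fst (\<omega> t) \<in> - cube}"])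
        (auto simp: space_L L.emeasure_eq_measure)
  qed

  \<comment> \<open>Combination of the events and the regret on them\<close>
  have "1 - 2 * \<delta> - l * s - 2 / N \<le> L.prob (E \<inter> {\<omega>. past l \<omega> \<in> G} - ?many)"
  proof -
    let ?G = "{\<omega>. past l \<omega> \<in> G}"
    have evG': "?G \<in> L.events" unfolding \<mu>_def by (rule evG)
    have "L.prob E + L.prob ?G \<le> L.prob (E \<inter> ?G) + 1"
      using L.finite_measure_Union'[OF E(1) evG'] L.prob_le_1[of "E \<union> ?G"]
        L.finite_measure_Diff'[OF evG' E(1)] by (simp add: Int_commute)
    moreover have "L.prob (E \<inter> ?G) - L.prob ?many \<le> L.prob (E \<inter> ?G - ?many)"
      using L.finite_measure_Diff'[of "E \<inter> ?G" ?many] E(1) evG' many_ev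
        L.finite_measure_mono[of "E \<inter> ?G \<inter> ?many" ?many] by auto
    ultimately show ?thesis using E(2) prob_G many by simp
  qed
  also have "\<dots> \<le> L.prob {\<omega> \<in> space \<mu>. Suc l / (2 * N) \<le> regret cube ?\<beta> \<omega> T}"
  proof (rule L.finite_measure_mono_AE[OF _ ev])
    have "Suc l / (2 * N) \<le> regret cube ?\<beta> \<omega> T"
      if cube: "\<And>t. fst (\<omega> t) \<in> cube" and \<omega>: "\<omega> \<in> E \<inter> {\<omega>. past l \<omega> \<in> G} - ?many" for \<omega>
    proof -
      have few: "(\<Sum>t<Suc l. indicator (B t) \<omega>) < real (Suc l) / 2"
        using \<omega> by (simp add: space_L not_le del: sum.lessThan_Suc of_nat_Suc)
      have "1 / N * (1 - indicator (B t) \<omega>) \<le> 1 - fst (\<omega> t) $ p" if t: "t < Suc l" for t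
      proof (cases "\<omega> \<in> B t")
        case True
        then show ?thesis using cube[of t] by (auto simp: cube_def)
      next
        case False
        \<comment> \<open>\<open>E\<close> and \<open>G\<close> put the past into
          \<open>H t\<close>, so outside \<open>B t\<close> the choice must miss
          \<open>top\<close>.\<close>
        then have "fst (\<omega> t) \<notin> top" using past_H[of \<omega> t] \<omega> t by (auto simp: B_def)
        with False show ?thesis by (simp add: top_def)
      qed
      then have "(\<Sum>t<Suc l. 1 / N * (1 - indicator (B t) \<omega>)) \<le> (\<Sum>t<Suc l. 1 - fst (\<omega> t) $ p)"
        by (intro sum_mono) (simp only: lessThan_iff)
      also have "\<dots> \<le> regret cube ?\<beta> \<omega> T"
        using s pq l cube by (intro regret_cube_ge) auto
      finally have le: "1 / N * (real (Suc l) - (\<Sum>t<Suc l. indicator (B t) \<omega>)) \<le> regret cube ?\<beta> \<omega> T"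
        by (simp only: sum_distrib_left[symmetric] sum_subtractf sum_constant card_lessThan mult_1_right)
      have "Suc l / (2 * N) = 1 / N * (real (Suc l) - real (Suc l) / 2)"
        using N by (simp add: field_simps)
      also have "\<dots> \<le> 1 / N * (real (Suc l) - (\<Sum>t<Suc l. indicator (B t) \<omega>))"
        using few by (intro mult_left_mono diff_left_mono) auto
      finally show ?thesis using le by simp
    qed
    with in_cube show "AE \<omega> in \<mu>. \<omega> \<in> E \<inter> {\<omega>. past l \<omega> \<in> G} - ?many \<longrightarrow>
        \<omega> \<in> {\<omega> \<in> space \<mu>. Suc l / (2 * N) \<le> regret cube ?\<beta> \<omega> T}"
      by (auto elim!: eventually_mono simp: space_L simp del: of_nat_Suc)
  qed
  finally show ?thesis .
qed

theorem theorem3: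
  assumes "CARD('n::finite) \<ge> 2"
  shows "\<exists>(a::real) (c :: real \<Rightarrow> real) (k::nat).
    0 < a \<and> (\<forall>\<epsilon>\<in>{0<..1}. 0 < c \<epsilon>) \<and>
    (\<forall>\<Delta>::real. 0 < \<Delta> \<and> \<Delta> \<le> 2 \<longrightarrow>
      (\<exists>D :: (real ^ 'n) pmf.
        (\<forall>\<beta> \<in> set_pmf D. \<beta> \<in> cube \<and> gap cube \<beta> \<ge> a * \<Delta>) \<and>
        (\<forall>\<A>. fair_algorithm cube cube \<A> \<longrightarrow>
          (\<forall>\<delta>\<in>{0<..1}. \<forall>\<epsilon>\<in>{0<..1}. \<forall>T::nat. real T \<ge> 1 / \<Delta> \<longrightarrow>
            prob_regret_ge cube D (\<A> \<delta>) T (c \<epsilon> / (\<Delta> * (1 + ln (2 / \<Delta>)) ^ k))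
              \<ge> 1 - 2 * \<delta> - \<epsilon>))))"
proof -
  \<comment> \<open>The dimension enters here: \<open>q\<close> carries the entry of uncertain sign,
    and \<open>p\<close> is the coordinate in which mass is moved down.\<close>
  obtain p q :: 'n where pq: "p \<noteq> q"
  proof -
    have "\<not> CARD('n) \<le> Suc 0" using assms by simp
    then show thesis using that card_le_Suc0_iff_eq[of "UNIV :: 'n set"] by auto
  qed
  have main: "1 - 2 * \<delta> - \<epsilon> \<le> prob_regret_ge cube (return_pmf (tilted q (\<Delta> / 2))) (\<A> \<delta>) T (\<epsilon>\<^sup>2 / 72 / \<Delta>)"
    if \<Delta>: "0 < \<Delta>" "\<Delta> \<le> 2" and fair: "fair_algorithm cube cube \<A>" and \<delta>: "\<delta> \<in> {0<..1}"
      and \<epsilon>: "\<epsilon> \<in> {0<..1}" and T: "1 / \<Delta> \<le> real T"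
    for \<Delta> \<delta> \<epsilon> :: real and \<A> :: "real \<Rightarrow> (real ^ 'n) policy" and T :: nat
  proof -
    \<comment> \<open>This makes the Markov term \<open>2 / N\<close> at most
      \<open>\<epsilon> / 4\<close>.\<close>
    define N where "N = nat \<lceil>8 / \<epsilon>\<rceil>"
    \<comment> \<open>This makes the cost \<open>l * (\<Delta> / 2)\<close> of the change of
      instance at most \<open>\<epsilon> / 8\<close>. Rounding down may give \<open>l = 0\<close>;
      one round is then still counted.\<close>
    define l where "l = nat \<lfloor>\<epsilon> / (4 * \<Delta>)\<rfloor>"
    let ?\<beta> = "tilted q (\<Delta> / 2)"
    let ?\<mu> = "trajectory_law ?\<beta> (\<A> \<delta>)"
    have \<epsilon>01: "0 < \<epsilon>" "\<epsilon> \<le> 1" using \<epsilon> by auto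
    have "real N = of_int \<lceil>8 / \<epsilon>\<rceil>" using \<epsilon>01 by (simp add: N_def)
    then have N: "8 / \<epsilon> \<le> N" "N \<le> 8 / \<epsilon> + 1" by linarith+
    have N0: "0 < N" using N(1) \<epsilon>01 by (cases N) (auto simp: divide_le_0_iff)
    have l: "l \<le> \<epsilon> / (4 * \<Delta>)" "\<epsilon> / (4 * \<Delta>) \<le> Suc l"
    proof -
      have "real l = of_int \<lfloor>\<epsilon> / (4 * \<Delta>)\<rfloor>" using \<epsilon>01 \<Delta> by (simp add: l_def)
      then show "l \<le> \<epsilon> / (4 * \<Delta>)" "\<epsilon> / (4 * \<Delta>) \<le> Suc l" by linarith+
    qed
    have "l < T"
    proof -
      have "\<epsilon> / (4 * \<Delta>) < 1 / \<Delta>" using \<epsilon>01 \<Delta> by (simp add: field_simps)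
      with l T show ?thesis by linarith
    qed
    then have "1 - 2 * \<delta> - l * (\<Delta> / 2) - 2 / N \<le>
        measure ?\<mu> {\<omega> \<in> space ?\<mu>. Suc l / (2 * N) \<le> regret cube ?\<beta> \<omega> T}"
      using \<Delta> by (intro prob_regret_tilted_ge[OF pq _ _ fair \<delta> N0]) auto
    moreover have "l * (\<Delta> / 2) + 2 / N \<le> \<epsilon>"
    proof -
      have "l * (\<Delta> / 2) \<le> \<epsilon> / (4 * \<Delta>) * (\<Delta> / 2)" using l \<Delta> by (intro mult_right_mono) auto
      moreover have "2 / N \<le> \<epsilon> / 4" using N(1) N0 \<epsilon>01 by (simp add: field_simps)
      moreover have "\<epsilon> / (4 * \<Delta>) * (\<Delta> / 2) = \<epsilon> / 8" using \<Delta> by simp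
      ultimately show ?thesis using \<epsilon>01 by linarith
    qed
    moreover have "measure ?\<mu> {\<omega> \<in> space ?\<mu>. Suc l / (2 * N) \<le> regret cube ?\<beta> \<omega> T} \<le>
        measure ?\<mu> {\<omega> \<in> space ?\<mu>. \<epsilon>\<^sup>2 / 72 / \<Delta> \<le> regret cube ?\<beta> \<omega> T}"
    proof -
      have \<pi>: "is_policy cube (\<A> \<delta>)" using fair \<delta> by (auto simp: fair_algorithm_def)
      interpret prob_space ?\<mu> by (rule prob_space_trajectory_law[OF \<pi>])
      have [measurable]: "(\<lambda>\<omega>. fst (\<omega> t)) \<in> borel_measurable ?\<mu>" for t
        by (rule measurable_trajectory_law[OF \<pi>])
      \<comment> \<open>The constant 72 is 4 * 2 * 9: from
        \<open>\<epsilon> / (4 * \<Delta>)\<close> rounds, from half of them being cheap, and from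
        this bound on \<open>N\<close>.\<close>
      have "N \<le> 9 / \<epsilon>" using N(2) \<epsilon>01 by (simp add: field_simps)
      then have "\<epsilon>\<^sup>2 / 72 / \<Delta> \<le> \<epsilon> / (4 * \<Delta>) / (2 * N)"
        using \<epsilon>01 \<Delta> N0 by (simp add: field_simps power2_eq_square)
      also have "\<dots> \<le> Suc l / (2 * N)" using l by (intro divide_right_mono) auto
      finally show ?thesis
        by (intro finite_measure_mono) (auto simp: regret_def simp del: of_nat_Suc)
    qed
    ultimately show ?thesis by (simp add: prob_regret_ge_def)
  qed
  show ?thesis
  \<comment> \<open>The smallest entry \<open>\<Delta> / 2\<close> gives the gap at least
    \<open>\<Delta>\<close>, hence the factor 1; the exponent 0 says that no logarithmic factor is
    lost.\<close>
  proof (rule exI[of _ 1], rule exI[of _ "\<lambda>\<epsilon>. \<epsilon>\<^sup>2 / 72"], rule exI[of _ 0], intro conjI allI impI)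
    fix \<Delta> :: real assume \<Delta>: "0 < \<Delta> \<and> \<Delta> \<le> 2"
    have "tilted q (\<Delta> / 2) \<in> (cube :: (real ^ 'n) set)" using \<Delta> by (auto simp: cube_def)
    moreover have "\<Delta> \<le> gap cube (tilted q (\<Delta> / 2) :: real ^ 'n)"
      using gap_tilted_ge[of "\<Delta> / 2" q] \<Delta> by simp
    ultimately show "\<exists>D :: (real ^ 'n) pmf.
        (\<forall>\<beta> \<in> set_pmf D. \<beta> \<in> cube \<and> gap cube \<beta> \<ge> 1 * \<Delta>) \<and>
        (\<forall>\<A>. fair_algorithm cube cube \<A> \<longrightarrow>
          (\<forall>\<delta>\<in>{0<..1}. \<forall>\<epsilon>\<in>{0<..1}. \<forall>T::nat. real T \<ge> 1 / \<Delta> \<longrightarrow>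
            prob_regret_ge cube D (\<A> \<delta>) T (\<epsilon>\<^sup>2 / 72 / (\<Delta> * (1 + ln (2 / \<Delta>)) ^ 0))
              \<ge> 1 - 2 * \<delta> - \<epsilon>))"
      using main \<Delta> by (intro exI[of _ "return_pmf (tilted q (\<Delta> / 2))"]) auto
  qed auto
qed

end
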